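(* Let $R$ be a finite commutative ring with identity with Artin decomposition $R=R_1\times\cdots\times R_s$, where each $R_i$ is a local ring with maximal ideal $\mathfrak{m}_i$ and residue field $R_i/\mathfrak{m}_i\simeq\mathbb{F}_{q_i}$, and let $k\in\mathbb{N}$. If $\gcd(k,|R|)=1$, then $G_R(k)$ is (strongly) connected if and only if (a) $\frac{q_i-1}{k_i}\dagger q_i-1$ for all $i\in\{1,\dots,s\}$, where $k_i=\gcd(k,q_i-1)$; and (b) there are no two (distinct) indices $i,j\in\{1,\dots,s\}$ such that $$G_{R_i/\mathfrak{m}_i}(k)\simeq\Gamma(p-1,p)\simeq G_{R_j/\mathfrak{m}_j}(k)$$ for some prime $p$.
   Context: For a commutative ring $R$ with identity and a positive integer $k$, $R^*$ is the group of units and $U_{R,k}=\{x^k:x\in R^*\}$. For an abelian group $A$ and $S\subseteq A$ with $0\notin S$, $X(A,S)$ denotes the Cayley digraph with vertex set $A$ and an arc from $v$ to $w$ iff $w-v\in S$; it is undirected if $S=-S$ and directed otherwise. Define $G_R(k)=X(R,U_{R,k})$; for a finite field, the generalized Paley graph is $\Gamma(k,q)=X(\mathbb{F}_q,\{x^k:x\in\mathbb{F}_q^*\})=G_{\mathbb{F}_q}(k)$. "(Strongly) connected" means connected if the graph is undirected, and strongly connected (a directed path in each direction between any two vertices) if it is directed. For a prime power $q=p^m$ ($p$ prime), $n\dagger q-1$ means that $n$ is a primitive divisor of $p^m-1$: $n\mid p^m-1$ and $n\nmid p^a-1$ for all $1\le a<m$. $\simeq$ between graphs denotes (di)graph isomorphism.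 *)

theory Defs
  imports
    "HOL-Algebra.Chinese_Remainder"
    "HOL-Algebra.QuotRing"
    "HOL-Number_Theory.Residues"
    "Graph_Theory.Digraph_Isomorphism"
begin

text \<open>
  An abelian group is written multiplicatively here; it will be instantiated by the additive group
  \<^term>\<open>add_monoid R\<close> of a ring, for which \<open>w \<otimes> inv v\<close> reads \<open>w - v\<close>.
  Undirected graphs are identified with symmetric digraphs. Loop-freeness, i.e. the identity not
  lying in \<open>S\<close>, is not built into the definition.
\<close>

definition cayley_digraph :: "('a, 'm) monoid_scheme \<Rightarrow> 'a set \<Rightarrow> ('a, 'a \<times> 'a) pre_digraph" where
  "cayley_digraph A S =
     with_proj \<lparr> pverts = carrier A,
                 parcs = {(v, w). v \<in> carrier A \<and> w \<in> carrier A \<and> w \<otimes>\<^bsub>A\<^esub> inv\<^bsub>A\<^esub> v \<in> S} \<rparr>"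

lemma symmetric_cayley_digraph_iff:
  assumes "comm_group A" and "S \<subseteq> carrier A"
  shows "Digraph.symmetric (cayley_digraph A S) \<longleftrightarrow> S = m_inv A ` S"
proof -
  interpret comm_group A by (rule assms(1))
  have ends: "arcs_ends (cayley_digraph A S)
      = {(v, w). v \<in> carrier A \<and> w \<in> carrier A \<and> w \<otimes>\<^bsub>A\<^esub> inv\<^bsub>A\<^esub> v \<in> S}"
    by (auto simp: cayley_digraph_def arcs_ends_def arc_to_ends_def)
  have inv_diff: "inv\<^bsub>A\<^esub> (w \<otimes>\<^bsub>A\<^esub> inv\<^bsub>A\<^esub> v) = v \<otimes>\<^bsub>A\<^esub> inv\<^bsub>A\<^esub> w"
    if "v \<in> carrier A" "w \<in> carrier A" for v w
    using that by (simp add: inv_mult_group)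
  show ?thesis
  proof
    assume sym: "Digraph.symmetric (cayley_digraph A S)"
    have *: "inv\<^bsub>A\<^esub> s \<in> S" if "s \<in> S" for s
    proof -
      have s: "s \<in> carrier A" using that assms(2) by auto
      have "(\<one>\<^bsub>A\<^esub>, s) \<in> arcs_ends (cayley_digraph A S)" using that s by (simp add: ends)
      hence "(s, \<one>\<^bsub>A\<^esub>) \<in> arcs_ends (cayley_digraph A S)"
        using sym unfolding Digraph.symmetric_def by (auto dest: symD)
      thus ?thesis using s by (simp add: ends)
    qed
    show "S = m_inv A ` S"
    proof
      show "m_inv A ` S \<subseteq> S" using * by auto
      show "S \<subseteq> m_inv A ` S"
      proof
        fix s assume "s \<in> S"
        moreover have "s = inv\<^bsub>A\<^esub> (inv\<^bsub>A\<^esub> s)" using \<open>s \<in> S\<close> assms(2) by auto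
        ultimately show "s \<in> m_inv A ` S" using * by (metis imageI)
      qed
    qed
  next
    assume "S = m_inv A ` S"
    hence *: "inv\<^bsub>A\<^esub> s \<in> S" if "s \<in> S" for s using that by blast
    have "v \<otimes>\<^bsub>A\<^esub> inv\<^bsub>A\<^esub> w \<in> S"
      if "v \<in> carrier A" "w \<in> carrier A" "w \<otimes>\<^bsub>A\<^esub> inv\<^bsub>A\<^esub> v \<in> S" for v w
      using *[OF that(3)] inv_diff[OF that(1,2)] by metis
    thus "Digraph.symmetric (cayley_digraph A S)"
      unfolding Digraph.symmetric_def ends sym_def by blast
  qed
qed

definition unit_powers :: "('a, 'm) ring_scheme \<Rightarrow> nat \<Rightarrow> 'a set" where
  "unit_powers R k = {x [^]\<^bsub>R\<^esub> k | x. x \<in> Units R}"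

definition unit_power_graph :: "('a, 'm) ring_scheme \<Rightarrow> nat \<Rightarrow> ('a, 'a \<times> 'a) pre_digraph" where
  "unit_power_graph R k = cayley_digraph (add_monoid R) (unit_powers R k)"

text \<open>The generalized Paley graph \<open>\<Gamma>(k, p)\<close> over the prime field with \<open>p\<close> elements.\<close>

definition paley_graph_prime :: "nat \<Rightarrow> nat \<Rightarrow> (int, int \<times> int) pre_digraph" where
  "paley_graph_prime k p = unit_power_graph (residue_ring (int p)) k"

definition strongly_or_undirected_connected :: "('a, 'b) pre_digraph \<Rightarrow> bool" where
  "strongly_or_undirected_connected G \<longleftrightarrow>
     (if Digraph.symmetric G then Digraph_Component.connected G
      else Digraph_Component.strongly_connected G)"

definition local_ring_with :: "('a, 'm) ring_scheme \<Rightarrow> 'a set \<Rightarrow> bool" where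
  "local_ring_with R M \<longleftrightarrow>
     cring R \<and> maximalideal M R \<and> (\<forall>J. maximalideal J R \<longrightarrow> J = M)"

text \<open>
  \<open>primitive_divisor n q\<close> says that \<open>n\<close> is a primitive divisor of \<open>q - 1\<close>, for a prime power
  \<open>q\<close>. The argument is \<open>q\<close> itself; \<open>p\<close> and \<open>m\<close> are uniquely determined by it.
\<close>

definition primitive_divisor :: "nat \<Rightarrow> nat \<Rightarrow> bool" where
  "primitive_divisor n q \<longleftrightarrow>
     (\<exists>p m. prime p \<and> 1 \<le> m \<and> q = p ^ m \<and> n dvd p ^ m - 1 \<and>
            (\<forall>a. 1 \<le> a \<and> a < m \<longrightarrow> \<not> n dvd p ^ a - 1))"

end

theory Submission
  imports Defs "HOL-Algebra.Sylow" "HOL-Algebra.Subrings"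
begin

text \<open>
  Let \<open>U\<close> be the set of \<open>k\<close>-th powers of units of \<open>R\<close>, and let \<open>K\<close> be the additive subgroup that it
  generates. Since \<open>R\<close> is finite, sums of elements of \<open>U\<close> already exhaust \<open>K\<close>, so the graph is
  (strongly) connected if and only if \<open>K = R\<close> (\<open>connected_cayley_digraph_iff\<close>). As \<open>U\<close> is
  closed under multiplication, \<open>K\<close> is a subring (\<open>subring_unit_power_span\<close>).

  The hypothesis on \<open>gcd\<close> reduces the question to a product of fields. Let \<open>J\<close> be the Jacobson radical,
  which is the common kernel of the maps from \<open>R\<close> to the residue fields of its local factors. The
  multiplicative group \<open>1 + J\<close> has order \<open>card J\<close>, which is coprime to \<open>k\<close>, so that it
  consists of \<open>k\<close>-th powers and \<open>J \<subseteq> K\<close> (\<open>radical_subset_span\<close>). Thus \<open>K = R\<close> if and only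
  if \<open>K\<close> maps onto the product of the residue fields.

  One condition for this is that \<open>K\<close> maps onto each residue field separately. In a finite field, the
  \<open>k\<close>-th powers generate the smallest subfield that contains them, and this is everything exactly
  under the primitive divisor condition (\<open>unit_power_span_eq_carrier_iff_primitive\<close>). The
  other is that \<open>K\<close> separates any two coordinates \<open>i\<close> and \<open>j\<close>. If one of the two fields
  has a \<open>k\<close>-th power \<open>u \<noteq> 1\<close>, then this succeeds with the help of \<open>u - 1\<close>
  (\<open>unit_power_span_isolate\<close>). If \<open>1\<close> is the only \<open>k\<close>-th power in both, the first condition makes
  them prime fields, and integer multiples of \<open>1\<close> separate them exactly if their orders differ
  (\<open>unit_power_span_separate\<close>, \<open>equal_characteristic_obstruction\<close>).

  Finally, a field with \<open>p\<close> elements whose only \<open>k\<close>-th power is \<open>1\<close> is recognized by its unit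
  power graph being the directed cycle \<open>\<Gamma>(p - 1, p)\<close>
  (\<open>digraph_iso_paley_graph_prime_iff\<close>).
\<close>

section \<open>Connectedness and isomorphism of Cayley digraphs\<close>

lemma cayley_digraph_simps [simp]:
  "verts (cayley_digraph A S) = carrier A"
  "arcs (cayley_digraph A S) =
     {(v, w). v \<in> carrier A \<and> w \<in> carrier A \<and> w \<otimes>\<^bsub>A\<^esub> inv\<^bsub>A\<^esub> v \<in> S}"
  "arcs_ends (cayley_digraph A S) =
     {(v, w). v \<in> carrier A \<and> w \<in> carrier A \<and> w \<otimes>\<^bsub>A\<^esub> inv\<^bsub>A\<^esub> v \<in> S}"
  "tail (cayley_digraph A S) = fst"
  "head (cayley_digraph A S) = snd"
  by (simp_all add: cayley_digraph_def)

lemma wf_cayley_digraph: "wf_digraph (cayley_digraph A S)"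
  by unfold_locales auto

lemma (in group) finite_submonoid_is_subgroup:
  assumes fin: "finite (carrier G)" and sub: "H \<subseteq> carrier G" and one: "\<one> \<in> H"
    and mult: "\<And>x y. x \<in> H \<Longrightarrow> y \<in> H \<Longrightarrow> x \<otimes> y \<in> H"
  shows "subgroup H G"
proof (rule subgroupI)
  fix h assume h: "h \<in> H"
  have pow: "h [^] n \<in> H" for n :: nat
    by (induction n) (use one mult h in auto)
  have "order G \<noteq> 0"
    using fin order_gt_0_iff_finite by auto
  then obtain n where n: "order G = Suc n"
    using not0_implies_Suc by blast
  have "h [^] n \<otimes> h = \<one>"
    using pow_order_eq_1[of h] h sub n by auto
  hence "inv h = h [^] n"
    using h sub by (intro inv_equality) auto
  thus "inv h \<in> H"
    using pow by simp
qed (use assms in auto)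

text \<open>
  Walking along arcs adds elements of \<open>S\<close>, so a priori only the submonoid generated by \<open>S\<close> is
  reached. In a finite group this submonoid is already a subgroup, which makes directed and
  undirected reachability the same.
\<close>

lemma cayley_digraph_reachable_iff:
  assumes A: "comm_group A" and fin: "finite (carrier A)" and S: "S \<subseteq> carrier A"
    and v: "v \<in> carrier A" and w: "w \<in> carrier A"
  shows "v \<rightarrow>\<^sup>*\<^bsub>cayley_digraph A S\<^esub> w \<longleftrightarrow> w \<otimes>\<^bsub>A\<^esub> inv\<^bsub>A\<^esub> v \<in> generate A S"
proof
  interpret comm_group A by (rule A)
  interpret D: wf_digraph "cayley_digraph A S" by (rule wf_cayley_digraph)
  interpret gen: subgroup "generate A S" A
    using generate_is_subgroup[OF S] .
  {
    assume "v \<rightarrow>\<^sup>*\<^bsub>cayley_digraph A S\<^esub> w"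
    thus "w \<otimes>\<^bsub>A\<^esub> inv\<^bsub>A\<^esub> v \<in> generate A S"
    proof (induction rule: D.reachable_induct)
      case base
      thus ?case using gen.one_closed v by simp
    next
      case (step x y)
      hence x: "x \<in> carrier A" and y: "y \<in> carrier A" and s: "y \<otimes>\<^bsub>A\<^esub> inv\<^bsub>A\<^esub> x \<in> S"
        by auto
      have "(y \<otimes>\<^bsub>A\<^esub> inv\<^bsub>A\<^esub> x) \<otimes>\<^bsub>A\<^esub> (x \<otimes>\<^bsub>A\<^esub> inv\<^bsub>A\<^esub> v) \<in> generate A S"
        using gen.m_closed[OF generate.incl[OF s] step.IH] .
      moreover have "(y \<otimes>\<^bsub>A\<^esub> inv\<^bsub>A\<^esub> x) \<otimes>\<^bsub>A\<^esub> (x \<otimes>\<^bsub>A\<^esub> inv\<^bsub>A\<^esub> v) = y \<otimes>\<^bsub>A\<^esub> inv\<^bsub>A\<^esub> v"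
        using x y v by (simp add: m_assoc) (simp add: m_assoc[symmetric])
      ultimately show ?case by simp
    qed
  }
  \<comment> \<open>The translations that are reachable from every starting point at once; unlike the set of
      vertices reachable from one point, this set is visibly closed under products.\<close>
  define H where "H = {h \<in> carrier A. \<forall>x\<in>carrier A. x \<rightarrow>\<^sup>*\<^bsub>cayley_digraph A S\<^esub> (h \<otimes>\<^bsub>A\<^esub> x)}"
  have "subgroup H A"
  proof (rule finite_submonoid_is_subgroup[OF fin])
    fix g h assume g: "g \<in> H" and h: "h \<in> H"
    have "x \<rightarrow>\<^sup>*\<^bsub>cayley_digraph A S\<^esub> (g \<otimes>\<^bsub>A\<^esub> h \<otimes>\<^bsub>A\<^esub> x)" if x: "x \<in> carrier A" for x
    proof -
      have "x \<rightarrow>\<^sup>*\<^bsub>cayley_digraph A S\<^esub> (h \<otimes>\<^bsub>A\<^esub> x)"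
        using h x by (auto simp: H_def)
      also have "(h \<otimes>\<^bsub>A\<^esub> x) \<rightarrow>\<^sup>*\<^bsub>cayley_digraph A S\<^esub> (g \<otimes>\<^bsub>A\<^esub> (h \<otimes>\<^bsub>A\<^esub> x))"
        using g h x by (auto simp: H_def)
      finally show ?thesis
        using g h x by (auto simp: H_def m_assoc)
    qed
    thus "g \<otimes>\<^bsub>A\<^esub> h \<in> H"
      using g h by (auto simp: H_def)
  qed (auto simp: H_def)
  moreover have "S \<subseteq> H"
  proof
    fix s assume s: "s \<in> S"
    have "x \<rightarrow>\<^sup>*\<^bsub>cayley_digraph A S\<^esub> (s \<otimes>\<^bsub>A\<^esub> x)" if x: "x \<in> carrier A" for x
      using s S x by (intro D.reachable_adjI) (auto simp: m_assoc)
    thus "s \<in> H" using s S by (auto simp: H_def)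
  qed
  ultimately have gen_H: "generate A S \<subseteq> H"
    using generate_subgroup_incl by blast
  assume "w \<otimes>\<^bsub>A\<^esub> inv\<^bsub>A\<^esub> v \<in> generate A S"
  hence "v \<rightarrow>\<^sup>*\<^bsub>cayley_digraph A S\<^esub> ((w \<otimes>\<^bsub>A\<^esub> inv\<^bsub>A\<^esub> v) \<otimes>\<^bsub>A\<^esub> v)"
    using gen_H v by (auto simp: H_def)
  thus "v \<rightarrow>\<^sup>*\<^bsub>cayley_digraph A S\<^esub> w"
    using v w by (simp add: m_assoc)
qed

lemma mk_symmetric_cayley_digraph:
  assumes "Digraph.symmetric (cayley_digraph A S)"
  shows "with_proj (mk_symmetric (cayley_digraph A S)) = cayley_digraph A S"
proof -
  have "(w, v) \<in> arcs_ends (cayley_digraph A S)" if "(v, w) \<in> arcs_ends (cayley_digraph A S)" for v w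
    using assms that unfolding Digraph.symmetric_def by (auto dest: symD)
  hence "(\<Union>e\<in>arcs (cayley_digraph A S). {(fst e, snd e), (snd e, fst e)}) = arcs (cayley_digraph A S)"
    by force
  thus ?thesis
    by (simp add: mk_symmetric_def cayley_digraph_def)
qed

text \<open>
  The case distinction between connected and strongly connected disappears here: symmetrizing a
  symmetric Cayley digraph leaves it unchanged.
\<close>

lemma connected_cayley_digraph_iff:
  assumes A: "comm_group A" and fin: "finite (carrier A)" and S: "S \<subseteq> carrier A"
  shows "strongly_or_undirected_connected (cayley_digraph A S) \<longleftrightarrow> generate A S = carrier A"
proof -
  interpret comm_group A by (rule A)
  have "strongly_or_undirected_connected (cayley_digraph A S)
      \<longleftrightarrow> Digraph_Component.strongly_connected (cayley_digraph A S)"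
    by (simp add: strongly_or_undirected_connected_def connected_def mk_symmetric_cayley_digraph)
  also have "\<dots> \<longleftrightarrow> (\<forall>v\<in>carrier A. \<forall>w\<in>carrier A. w \<otimes>\<^bsub>A\<^esub> inv\<^bsub>A\<^esub> v \<in> generate A S)"
    using carrier_not_empty
    by (auto simp: strongly_connected_def cayley_digraph_reachable_iff[OF A fin S])
  also have "\<dots> \<longleftrightarrow> generate A S = carrier A"
  proof
    assume *: "\<forall>v\<in>carrier A. \<forall>w\<in>carrier A. w \<otimes>\<^bsub>A\<^esub> inv\<^bsub>A\<^esub> v \<in> generate A S"
    have "w \<in> generate A S" if "w \<in> carrier A" for w
      using bspec[OF bspec[OF * one_closed] that] that by simp
    thus "generate A S = carrier A"
      using generate_incl[OF S] by auto
  qed auto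
  finally show ?thesis .
qed

lemma digraph_iso_cayley_digraphI:
  assumes bij: "bij_betw f (carrier A) (carrier B)"
    and arcs: "\<And>v w. v \<in> carrier A \<Longrightarrow> w \<in> carrier A \<Longrightarrow>
      w \<otimes>\<^bsub>A\<^esub> inv\<^bsub>A\<^esub> v \<in> S \<longleftrightarrow> f w \<otimes>\<^bsub>B\<^esub> inv\<^bsub>B\<^esub> f v \<in> T"
  shows "digraph_iso (cayley_digraph A S) (cayley_digraph B T)"
proof -
  define h where "h = \<lparr>iso_verts = f, iso_arcs = map_prod f f, iso_head = snd, iso_tail = fst\<rparr>"
  have inj: "inj_on f (carrier A)" and im: "f ` carrier A = carrier B"
    using bij by (auto simp: bij_betw_def)
  have "pre_digraph.digraph_isomorphism (cayley_digraph A S) h"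
    using inj wf_cayley_digraph[of A S]
    by (auto simp: pre_digraph.digraph_isomorphism_def h_def inj_on_def)
  moreover have "cayley_digraph B T = app_iso h (cayley_digraph A S)"
  proof (rule pre_digraph.equality)
    show "arcs (cayley_digraph B T) = arcs (app_iso h (cayley_digraph A S))"
    proof
      show "arcs (app_iso h (cayley_digraph A S)) \<subseteq> arcs (cayley_digraph B T)"
        using arcs im by (auto simp: h_def)
      show "arcs (cayley_digraph B T) \<subseteq> arcs (app_iso h (cayley_digraph A S))"
      proof
        fix e assume "e \<in> arcs (cayley_digraph B T)"
        moreover obtain x y where e: "e = (x, y)" by fastforce
        ultimately have xy: "x \<in> f ` carrier A" "y \<in> f ` carrier A" "y \<otimes>\<^bsub>B\<^esub> inv\<^bsub>B\<^esub> x \<in> T"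
          using im by auto
        then obtain v w where "v \<in> carrier A" "w \<in> carrier A" "x = f v" "y = f w"
          by auto
        thus "e \<in> arcs (app_iso h (cayley_digraph A S))"
          using xy(3) arcs e by (auto simp: h_def intro!: image_eqI[of _ _ "(v, w)"])
      qed
    qed
  qed (use im in \<open>auto simp: h_def\<close>)
  ultimately show ?thesis
    unfolding digraph_iso_def by blast
qed

text \<open>
  Counting arcs reads off \<open>card S\<close> from the isomorphism class of the digraph.
\<close>

lemma card_arcs_cayley_digraph:
  assumes A: "comm_group A" and S: "S \<subseteq> carrier A"
  shows "card (arcs (cayley_digraph A S)) = card (carrier A) * card S"
proof -
  interpret comm_group A by (rule A)
  have "bij_betw (\<lambda>(v, s). (v, s \<otimes>\<^bsub>A\<^esub> v)) (carrier A \<times> S) (arcs (cayley_digraph A S))"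
  proof (rule bij_betw_byWitness[where f' = "\<lambda>(v, w). (v, w \<otimes>\<^bsub>A\<^esub> inv\<^bsub>A\<^esub> v)"])
  qed (use S in \<open>auto simp: m_assoc\<close>)
  thus ?thesis
    by (simp only: bij_betw_same_card[symmetric] card_cartesian_product)
qed

lemma digraph_iso_card:
  assumes "digraph_iso G H"
  shows "card (verts G) = card (verts H)" and "card (arcs G) = card (arcs H)"
  using assms by (auto simp: digraph_iso_def pre_digraph.digraph_isomorphism_def card_image)

section \<open>The subring spanned by unit powers\<close>

text \<open>
  For a finite ring, the set of vertices reachable from \<open>0\<close> in the unit power graph. Only sums and
  differences of unit powers are taken, but the set turns out to be a subring.
\<close>

definition unit_power_span :: "('a, 'm) ring_scheme \<Rightarrow> nat \<Rightarrow> 'a set" where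
  "unit_power_span R k = generate (add_monoid R) (unit_powers R k)"

context cring
begin

lemma unit_powers_subset_Units: "unit_powers R k \<subseteq> Units R"
  by (auto simp: unit_powers_def intro: Units_pow_closed)

lemma unit_powers_closed: "unit_powers R k \<subseteq> carrier R"
  using unit_powers_subset_Units by auto

lemma one_in_unit_powers: "\<one> \<in> unit_powers R k"
  unfolding unit_powers_def by (auto intro!: exI[of _ \<one>])

lemma unit_powers_m_closed:
  assumes "x \<in> unit_powers R k" "y \<in> unit_powers R k"
  shows "x \<otimes> y \<in> unit_powers R k"
proof -
  obtain a b where "a \<in> Units R" "b \<in> Units R" "x = a [^] k" "y = b [^] k"
    using assms by (auto simp: unit_powers_def)
  thus ?thesis
    by (auto simp: unit_powers_def nat_pow_distrib Units_closed intro!: exI[of _ "a \<otimes> b"])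
qed

lemma subgroup_unit_power_span: "subgroup (unit_power_span R k) (add_monoid R)"
  unfolding unit_power_span_def by (rule add.generate_is_subgroup) (use unit_powers_closed in auto)

lemma unit_powers_subset_span: "unit_powers R k \<subseteq> unit_power_span R k"
  unfolding unit_power_span_def by (auto intro: generate.incl)

lemma unit_power_span_least:
  assumes "unit_powers R k \<subseteq> H" "subgroup H (add_monoid R)"
  shows "unit_power_span R k \<subseteq> H"
  unfolding unit_power_span_def by (rule add.generate_subgroup_incl[OF assms])

text \<open>
  Multiplicative closure holds because the generators are closed under multiplication: by
  distributivity, the multipliers that keep the span inside itself can be tested on generators, in one
  factor at a time.
\<close>

lemma subring_unit_power_span: "subring (unit_power_span R k) R"
proof -
  let ?K = "unit_power_span R k"
  interpret K: subgroup ?K "add_monoid R" by (rule subgroup_unit_power_span)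
  have sub: "?K \<subseteq> carrier R" using K.subset by simp
  have mult_left: "?K \<subseteq> {x \<in> carrier R. a \<otimes> x \<in> ?K}"
    if a: "a \<in> carrier R" and U: "\<And>x. x \<in> unit_powers R k \<Longrightarrow> a \<otimes> x \<in> ?K" for a
  proof (rule unit_power_span_least)
    show "unit_powers R k \<subseteq> {x \<in> carrier R. a \<otimes> x \<in> ?K}"
      using U unit_powers_closed by auto
    show "subgroup {x \<in> carrier R. a \<otimes> x \<in> ?K} (add_monoid R)"
    proof (rule add.subgroupI)
      fix x y assume "x \<in> {x \<in> carrier R. a \<otimes> x \<in> ?K}" "y \<in> {x \<in> carrier R. a \<otimes> x \<in> ?K}"
      thus "x \<oplus> y \<in> {x \<in> carrier R. a \<otimes> x \<in> ?K}"
        using K.m_closed a by (auto simp: r_distr)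
    next
      fix x assume x: "x \<in> {x \<in> carrier R. a \<otimes> x \<in> ?K}"
      hence "\<ominus> (a \<otimes> x) \<in> ?K" using K.m_inv_closed by (auto simp: a_inv_def)
      thus "\<ominus> x \<in> {x \<in> carrier R. a \<otimes> x \<in> ?K}"
        using x a by (auto simp: r_minus)
    qed (use a K.one_closed in \<open>auto intro!: exI[of _ \<zero>]\<close>)
  qed
  have U_mult: "u \<otimes> x \<in> ?K" if "u \<in> unit_powers R k" "x \<in> ?K" for u x
    using mult_left[of u] that unit_powers_m_closed unit_powers_subset_span unit_powers_closed
    by blast
  have mult: "x \<otimes> y \<in> ?K" if "x \<in> ?K" "y \<in> ?K" for x y
    using mult_left[of x] that U_mult m_comm sub unit_powers_closed by (metis (no_types, lifting) mem_Collect_eq subsetD)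
  show ?thesis
  proof (rule subringI)
    show "\<one> \<in> ?K" using one_in_unit_powers unit_powers_subset_span by blast
  qed (use sub mult K.m_closed K.m_inv_closed in \<open>auto simp: a_inv_def\<close>)
qed

end

section \<open>Finite fields\<close>

context cring
begin

lemma add_pow_nat_dvd_eq_zero:
  fixes p n :: nat
  assumes "[p] \<cdot> \<one> = \<zero>" and "p dvd n" and x: "x \<in> carrier R"
  shows "[n] \<cdot> x = \<zero>"
proof -
  obtain c where n: "n = p * c" using assms(2) by blast
  have "[p] \<cdot> x = \<zero>"
    using add_pow_ldistr[OF one_closed x, of p] assms(1) x by simp
  thus ?thesis
    using add.nat_pow_pow[OF x, of c p] by (simp add: n)
qed

lemma binomial_theorem:
  assumes x: "x \<in> carrier R" and y: "y \<in> carrier R"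
  shows "(x \<oplus> y) [^] n = (\<Oplus>i\<in>{..n}. [(n choose i)] \<cdot> (x [^] i \<otimes> y [^] (n - i)))"
proof (induction n)
  case 0
  show ?case by simp
next
  case (Suc n)
  let ?f = "\<lambda>i. [(n choose i)] \<cdot> (x [^] i \<otimes> y [^] (n - i))"
  let ?g = "\<lambda>i. [(n choose i)] \<cdot> (x [^] Suc i \<otimes> y [^] (n - i))"
  let ?h = "\<lambda>i. [(n choose i)] \<cdot> (x [^] i \<otimes> y [^] (Suc n - i))"
  let ?t = "\<lambda>i. [(Suc n choose i)] \<cdot> (x [^] i \<otimes> y [^] (Suc n - i))"
  have f: "?f \<in> A \<rightarrow> carrier R" and g: "?g \<in> A \<rightarrow> carrier R" and h: "?h \<in> A \<rightarrow> carrier R"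
    and t: "?t \<in> A \<rightarrow> carrier R" for A
    using x y by auto
  have "(\<Oplus>i\<in>{..n}. ?f i) \<otimes> x = (\<Oplus>i\<in>{..n}. ?f i \<otimes> x)"
    by (rule finsum_ldistr) (use x f in auto)
  also have "\<dots> = (\<Oplus>i\<in>{..n}. ?g i)"
    by (rule finsum_cong') (use x y in \<open>auto simp: add_pow_ldistr add_pow_rdistr m_ac\<close>)
  finally have 1: "(\<Oplus>i\<in>{..n}. ?f i) \<otimes> x = (\<Oplus>i\<in>{..n}. ?g i)" .
  have "(\<Oplus>i\<in>{..n}. ?f i) \<otimes> y = (\<Oplus>i\<in>{..n}. ?f i \<otimes> y)"
    by (rule finsum_ldistr) (use y f in auto)
  also have "\<dots> = (\<Oplus>i\<in>{..n}. ?h i)"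
    by (rule finsum_cong') (use x y in \<open>auto simp: add_pow_ldistr add_pow_rdistr m_ac Suc_diff_le\<close>)
  also have "\<dots> = (\<Oplus>i\<in>{..Suc n}. ?h i)"
    using h finsum_closed[OF h, of "{..n}"] x y by (subst finsum_Suc) (auto simp: binomial_eq_0)
  also have "\<dots> = (\<Oplus>i\<in>{..n}. ?h (Suc i)) \<oplus> ?h 0"
    by (rule finsum_Suc2) (use h in auto)
  finally have 2: "(\<Oplus>i\<in>{..n}. ?f i) \<otimes> y = (\<Oplus>i\<in>{..n}. ?h (Suc i)) \<oplus> ?h 0" .
  have "(x \<oplus> y) [^] Suc n = (\<Oplus>i\<in>{..n}. ?f i) \<otimes> x \<oplus> (\<Oplus>i\<in>{..n}. ?f i) \<otimes> y"
    using Suc.IH x y f by (simp add: r_distr)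
  also have "\<dots> = ((\<Oplus>i\<in>{..n}. ?g i) \<oplus> (\<Oplus>i\<in>{..n}. ?h (Suc i))) \<oplus> ?h 0"
    unfolding 1 2 using finsum_closed[OF g, of "{..n}"] finsum_closed[of "\<lambda>i. ?h (Suc i)" "{..n}"] x y
    by (simp add: a_assoc Pi_def)
  also have "(\<Oplus>i\<in>{..n}. ?g i) \<oplus> (\<Oplus>i\<in>{..n}. ?h (Suc i)) = (\<Oplus>i\<in>{..n}. ?g i \<oplus> ?h (Suc i))"
    by (rule finsum_addf[symmetric]) (use x y in auto)
  also have "\<dots> = (\<Oplus>i\<in>{..n}. ?t (Suc i))"
    by (rule finsum_cong') (use x y in \<open>auto simp: add.nat_pow_mult\<close>)
  also have "(\<Oplus>i\<in>{..n}. ?t (Suc i)) \<oplus> ?h 0 = (\<Oplus>i\<in>{..Suc n}. ?t i)"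
    by (subst finsum_Suc2) (use t in auto)
  finally show ?case .
qed

text \<open>
  The Frobenius identity: the inner binomial coefficients are multiples of \<open>p\<close>.
\<close>

lemma add_pow_prime_char:
  assumes p: "prime p" and char: "[p] \<cdot> \<one> = \<zero>" and x: "x \<in> carrier R" and y: "y \<in> carrier R"
  shows "(x \<oplus> y) [^] p = x [^] p \<oplus> y [^] (p::nat)"
proof -
  obtain m where m: "p = Suc (Suc m)"
    using prime_ge_2_nat[OF p] by (metis Suc_le_D numeral_2_eq_2 Suc_le_mono)
  let ?t = "\<lambda>i. [(p choose i)] \<cdot> (x [^] i \<otimes> y [^] (p - i))"
  have t: "?t \<in> A \<rightarrow> carrier R" for A using x y by auto
  have mid: "(\<Oplus>i\<in>{..m}. ?t (Suc i)) = (\<Oplus>i\<in>{..m}. \<zero>)"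
  proof (rule finsum_cong')
    fix i assume "i \<in> {..m}"
    hence "p dvd p choose Suc i"
      by (intro dvd_choose_prime) (use p m in auto)
    thus "?t (Suc i) = \<zero>"
      by (intro add_pow_nat_dvd_eq_zero[OF char]) (use x y in auto)
  qed auto
  have "(x \<oplus> y) [^] p = (\<Oplus>i\<in>{..Suc (Suc m)}. ?t i)"
    using binomial_theorem[OF x y, of p] by (simp add: m)
  also have "\<dots> = ?t p \<oplus> (\<Oplus>i\<in>{..Suc m}. ?t i)"
    by (subst finsum_Suc) (use t m in auto)
  also have "(\<Oplus>i\<in>{..Suc m}. ?t i) = (\<Oplus>i\<in>{..m}. ?t (Suc i)) \<oplus> ?t 0"
    by (rule finsum_Suc2) (use t in auto)
  also have "\<dots> = ?t 0"
    unfolding mid using x y by simp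
  finally show ?thesis
    using x y by simp
qed

lemma add_pow_prime_power_char:
  assumes p: "prime p" and char: "[p] \<cdot> \<one> = \<zero>" and x: "x \<in> carrier R" and y: "y \<in> carrier R"
  shows "(x \<oplus> y) [^] (p ^ a) = x [^] (p ^ a) \<oplus> y [^] (p ^ a :: nat)"
proof (induction a)
  case (Suc a)
  have "(x \<oplus> y) [^] (p ^ Suc a) = ((x \<oplus> y) [^] (p ^ a)) [^] p"
    using x y by (simp add: nat_pow_pow mult.commute)
  also have "\<dots> = (x [^] (p ^ a)) [^] p \<oplus> (y [^] (p ^ a)) [^] p"
    unfolding Suc.IH by (rule add_pow_prime_char[OF p char]) (use x y in auto)
  finally show ?case
    using x y by (simp add: nat_pow_pow mult.commute)
qed (use x y in simp)

end

context field
begin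

lemma finite_field_card_ge_2:
  assumes "finite (carrier R)"
  shows "2 \<le> card (carrier R)"
  using card_mono[OF assms, of "{\<zero>, \<one>}"] by simp

text \<open>
  Cauchy's theorem in the additive group gives, for each prime divisor \<open>r\<close> of the order, a nonzero
  element killed by \<open>r\<close>; cancelling it shows that \<open>r\<close> kills \<open>1\<close>. Two different primes cannot both
  do so.
\<close>

lemma finite_field_prime_power:
  assumes fin: "finite (carrier R)"
  obtains p m :: nat where "prime p" "1 \<le> m" "card (carrier R) = p ^ m" "[p] \<cdot> \<one> = \<zero>"
proof -
  let ?q = "card (carrier R)"
  have char: "[r] \<cdot> \<one> = \<zero>" if r: "prime r" "r dvd ?q" for r :: nat
  proof -
    obtain m where "?q = r ^ 1 * m" using r by auto
    hence "order (add_monoid R) = r ^ 1 * m" by (simp add: order_def)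
    then obtain H where H: "subgroup H (add_monoid R)" "card H = r"
      using sylow_thm[OF r(1) add.group_axioms, of 1 m] fin by auto
    have "\<not> H \<subseteq> {\<zero>}"
      using card_mono[of "{\<zero>}" H] H(2) prime_gt_1_nat[OF r(1)] by auto
    then obtain x where x: "x \<in> H" "x \<noteq> \<zero>" by auto
    have xc: "x \<in> carrier R" using x subgroup.subset[OF H(1)] by auto
    interpret H: group "add_monoid R \<lparr>carrier := H\<rparr>"
      using subgroup.subgroup_is_group[OF H(1) add.group_axioms] .
    have "x [^]\<^bsub>add_monoid R \<lparr>carrier := H\<rparr>\<^esub> r = \<zero>"
      using H.pow_order_eq_1[of x] x H(2) by (simp add: order_def)
    hence "[r] \<cdot> x = \<zero>"
      using add.nat_pow_consistent[where x = x and n = r and H = H] by (simp only: add_pow_def)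
    hence "[r] \<cdot> \<one> \<otimes> x = \<zero>"
      using xc by (simp add: add_pow_ldistr)
    thus ?thesis using x(2) xc integral by auto
  qed
  have q2: "2 \<le> ?q" by (rule finite_field_card_ge_2[OF fin])
  then obtain p where p: "prime p" "p dvd ?q"
    using prime_factor_nat[of ?q] by auto
  have uniq: "r = p" if r: "prime r" "r dvd ?q" for r
  proof (rule ccontr)
    assume "r \<noteq> p"
    hence "coprime r p" using primes_coprime r p by blast
    moreover have "add.ord \<one> dvd r" "add.ord \<one> dvd p"
      using char[OF r] char[OF p] add.pow_eq_id[of \<one>] by (auto simp: add_pow_def)
    ultimately have "add.ord \<one> = 1"
      using coprime_common_divisor_nat by blast
    thus False using add.ord_eq_1[of \<one>] by simp
  qed
  obtain u where u: "?q = p ^ multiplicity p ?q * u" "\<not> p dvd u"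
    using multiplicity_decompose'[of ?q p] q2 p(1) by (metis not_prime_unit not_numeral_le_zero)
  have "u = 1"
  proof (rule ccontr)
    assume "u \<noteq> 1"
    then obtain r where "prime r" "r dvd u" using prime_factor_nat by blast
    thus False using uniq[of r] u by (metis dvd_mult)
  qed
  moreover have "1 \<le> multiplicity p ?q"
    using p q2 by (simp add: Suc_leI prime_multiplicity_gt_zero_iff)
  ultimately show thesis
    using that[of p "multiplicity p ?q"] p u char by simp
qed

text \<open>
  The \<open>k\<close>-th powers are the powers of \<open>u = g ^ k\<close> for a primitive root \<open>g\<close>. Both \<open>g\<close> and \<open>u\<close> are
  recorded through their annihilating exponents, which is how they get compared with powers of the
  characteristic below.
\<close>

lemma unit_powers_cyclic:
  assumes fin: "finite (carrier R)" and k: "k \<ge> 1"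
  defines "n \<equiv> (card (carrier R) - 1) div gcd k (card (carrier R) - 1)"
  obtains g u where "g \<in> carrier R - {\<zero>}" "\<And>j::nat. g [^] j = \<one> \<longleftrightarrow> card (carrier R) - 1 dvd j"
    "u \<in> carrier R - {\<zero>}" "\<And>j::nat. u [^] j = \<one> \<longleftrightarrow> n dvd j"
    "unit_powers R k = {u [^] i | i::nat. True}"
proof -
  let ?q = "card (carrier R)"
  interpret G: group "mult_of R" rewrites
      "([^]\<^bsub>mult_of R\<^esub>) = (([^]) :: _ \<Rightarrow> nat \<Rightarrow> _)" and "\<one>\<^bsub>mult_of R\<^esub> = \<one>"
    by (rule field_mult_group) (simp_all add: fun_eq_iff nat_pow_def mult_of_def)
  obtain g where g: "g \<in> carrier (mult_of R)" "carrier (mult_of R) = {g [^] i | i::nat. i \<in> UNIV}"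
    using finite_field_mult_group_has_gen[OF fin] by blast
  have finG: "finite (carrier (mult_of R))" using fin by simp
  have "generate (mult_of R) {g} = carrier (mult_of R)"
    using G.generate_pow_on_finite_carrier[OF finG g(1)] g(2) by simp
  hence ordg: "G.ord g = ?q - 1"
    using G.generate_pow_card[OF g(1)] order_mult_of[OF fin] by (simp add: order_def)
  have gj: "g [^] j = \<one> \<longleftrightarrow> ?q - 1 dvd j" for j :: nat
    using G.pow_eq_id[OF g(1)] ordg by simp
  have gR: "g \<in> carrier R" using g(1) by simp
  have u: "g [^] k \<in> carrier (mult_of R)" using G.nat_pow_closed[OF g(1)] .
  have "G.ord (g [^] k) = n"
    using G.ord_pow_gen[OF g(1), of k] k ordg by (simp add: n_def gcd.commute)
  hence uj: "(g [^] k) [^] j = \<one> \<longleftrightarrow> n dvd j" for j :: nat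
    using G.pow_eq_id[OF u] by simp
  have "Units R = {g [^] i | i::nat. i \<in> UNIV}"
    using g(2) field_Units by simp
  hence "unit_powers R k = {(g [^] i) [^] k | i::nat. True}"
    by (auto simp: unit_powers_def)
  also have "\<dots> = {(g [^] k) [^] i | i::nat. True}"
    using gR by (simp add: nat_pow_pow mult.commute)
  finally have U: "unit_powers R k = {(g [^] k) [^] i | i::nat. True}" .
  show thesis
    by (rule that[OF _ gj _ uj U]) (use g(1) u in simp_all)
qed

lemma unit_powers_trivial_iff:
  assumes fin: "finite (carrier R)" and k: "k \<ge> 1"
  shows "unit_powers R k = {\<one>} \<longleftrightarrow>
    (card (carrier R) - 1) div gcd k (card (carrier R) - 1) = 1"
proof -
  let ?n = "(card (carrier R) - 1) div gcd k (card (carrier R) - 1)"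
  obtain g u where "g \<in> carrier R - {\<zero>}" "\<And>j::nat. g [^] j = \<one> \<longleftrightarrow> card (carrier R) - 1 dvd j"
    and u: "u \<in> carrier R - {\<zero>}" "\<And>j::nat. u [^] j = \<one> \<longleftrightarrow> ?n dvd j"
    "unit_powers R k = {u [^] i | i::nat. True}"
    by (rule unit_powers_cyclic[OF fin k]) (rule that)
  have "unit_powers R k = {\<one>} \<longleftrightarrow> u = \<one>"
  proof
    assume "unit_powers R k = {\<one>}"
    moreover have "u [^] (1::nat) \<in> unit_powers R k" using u(3) by blast
    ultimately show "u = \<one>" using u(1) by simp
  next
    assume "u = \<one>"
    thus "unit_powers R k = {\<one>}" using u(3) by simp
  qed
  also have "\<dots> \<longleftrightarrow> ?n = 1"
    using u(2)[of 1] u(1) by simp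
  finally show ?thesis .
qed

text \<open>
  The span is a subring of a finite field, hence a subfield. Let \<open>n\<close> be the order of the group of
  \<open>k\<close>-th powers. If \<open>n\<close> divides \<open>p ^ a - 1\<close> with \<open>1 \<le> a < m\<close>, then the group is fixed by the
  \<open>a\<close>-fold Frobenius map, and so is the whole span; but a primitive root is not fixed. Conversely,
  Lagrange's theorem applies to a proper span: additively it shows that the order of the span is a
  power of \<open>p\<close>, and multiplicatively that \<open>n\<close> divides this order minus one.
\<close>

theorem unit_power_span_eq_carrier_iff_primitive:
  assumes fin: "finite (carrier R)" and k: "k \<ge> 1"
  shows "unit_power_span R k = carrier R \<longleftrightarrow>
    primitive_divisor ((card (carrier R) - 1) div gcd k (card (carrier R) - 1)) (card (carrier R))"
proof -
  let ?q = "card (carrier R)"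
  let ?n = "(?q - 1) div gcd k (?q - 1)"
  let ?K = "unit_power_span R k"
  have q2: "2 \<le> ?q" by (rule finite_field_card_ge_2[OF fin])
  obtain g u where g: "g \<in> carrier R - {\<zero>}" "\<And>j::nat. g [^] j = \<one> \<longleftrightarrow> ?q - 1 dvd j"
    and u: "u \<in> carrier R - {\<zero>}" "\<And>j::nat. u [^] j = \<one> \<longleftrightarrow> ?n dvd j"
    and U: "unit_powers R k = {u [^] i | i::nat. True}"
    by (rule unit_powers_cyclic[OF fin k]) (rule that)
  have uR: "u \<in> carrier R" using u by simp
  show ?thesis
  proof
    assume all: "?K = carrier R"
    obtain p m where p: "prime p" "1 \<le> m" "?q = p ^ m" "[p] \<cdot> \<one> = \<zero>"
      by (rule finite_field_prime_power[OF fin])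
    have "\<not> ?n dvd p ^ a - 1" if a: "1 \<le> a" "a < m" for a
    proof
      assume n: "?n dvd p ^ a - 1"
      have pa: "p ^ a = Suc (p ^ a - 1)" "p ^ a - 1 \<noteq> 0"
        using one_less_power[of p a] prime_gt_1_nat[OF p(1)] a by auto
      have pow_u: "u [^] (p ^ a) = u"
        using n u(2) uR pa(1) by (metis nat_pow_Suc l_one)
      \<comment> \<open>The fixed field of the \<open>a\<close>-fold Frobenius map.\<close>
      define E where "E = {x \<in> carrier R. x [^] (p ^ a) = x}"
      have zero_pow: "\<zero> [^] (p ^ a) = \<zero>"
        using pa(1) nat_pow_closed[OF zero_closed] by (metis nat_pow_Suc r_null)
      have "subgroup E (add_monoid R)"
      proof (rule add.finite_submonoid_is_subgroup)
        fix x y assume "x \<in> E" "y \<in> E"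
        thus "x \<oplus> y \<in> E"
          using add_pow_prime_power_char[OF p(1,4), of x y a] by (auto simp: E_def)
      qed (use fin zero_pow in \<open>auto simp: E_def\<close>)
      moreover have "unit_powers R k \<subseteq> E"
      proof -
        have "(u [^] i) [^] (p ^ a) = u [^] i" for i :: nat
          using pow_u uR by (metis nat_pow_pow mult.commute)
        thus ?thesis using U uR by (auto simp: E_def)
      qed
      ultimately have "carrier R \<subseteq> E"
        using unit_power_span_least all by blast
      hence "g [^] (p ^ a) = g"
        using g(1) by (auto simp: E_def)
      hence "g [^] Suc (p ^ a - 1) = g"
        by (simp only: pa(1)[symmetric])
      hence "g [^] (p ^ a - 1) \<otimes> g = \<one> \<otimes> g"
        using g(1) by simp
      hence "g [^] (p ^ a - 1) = \<one>"
        using g(1) m_rcancel[of g "g [^] (p ^ a - 1)" \<one>] by simp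
      hence "?q - 1 \<le> p ^ a - 1"
        using g(2) pa(2) by (auto dest: dvd_imp_le)
      moreover have "p ^ a < p ^ m"
        using a prime_gt_1_nat[OF p(1)] by simp
      ultimately show False
        using p(3) pa by simp
    qed
    moreover have "?n dvd p ^ m - 1"
      unfolding p(3)[symmetric] by (metis dvd_triv_left dvd_mult_div_cancel gcd_dvd2 mult.commute)
    ultimately show "primitive_divisor ?n ?q"
      unfolding primitive_divisor_def using p by metis
  next
    assume "primitive_divisor ?n ?q"
    then obtain p m where p: "prime p" "1 \<le> m" "?q = p ^ m"
      and prim: "\<And>a. 1 \<le> a \<Longrightarrow> a < m \<Longrightarrow> \<not> ?n dvd p ^ a - 1"
      unfolding primitive_divisor_def by metis
    have K: "subring ?K R" by (rule subring_unit_power_span)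
    have sub: "?K \<subseteq> carrier R" by (rule subringE(1)[OF K])
    have finK: "finite ?K" using sub fin finite_subset by blast
    have "card ?K dvd ?q"
      using add.lagrange[OF subgroup_unit_power_span, of k] by (simp add: order_def) (metis dvd_triv_right)
    then obtain a where a: "a \<le> m" "card ?K = p ^ a"
      using p divides_primepow_nat by auto
    have K01: "\<zero> \<in> ?K" "\<one> \<in> ?K" using subringE[OF K] by auto
    hence "2 \<le> card ?K"
      using card_mono[OF finK, of "{\<zero>, \<one>}"] by simp
    hence a1: "1 \<le> a" using a(2) by (cases a) auto
    interpret G: group "mult_of R" by (rule field_mult_group)
    have "x \<otimes> y \<noteq> \<zero>" if "x \<in> ?K - {\<zero>}" "y \<in> ?K - {\<zero>}" for x y
      using that integral sub by blast
    hence H: "subgroup (?K - {\<zero>}) (mult_of R)"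
      by (intro G.finite_submonoid_is_subgroup) (use fin sub K01 subringE(6)[OF K] in auto)
    interpret H: group "mult_of R \<lparr>carrier := ?K - {\<zero>}\<rparr>"
      using subgroup.subgroup_is_group[OF H G.group_axioms] .
    have "u \<in> unit_powers R k"
      unfolding U using uR by (metis (mono_tags, lifting) mem_Collect_eq nat_pow_eone)
    hence "u \<in> ?K - {\<zero>}"
      using unit_powers_subset_span u(1) by auto
    hence "u [^]\<^bsub>mult_of R \<lparr>carrier := ?K - {\<zero>}\<rparr>\<^esub> (p ^ a - 1) = \<one>"
      using H.pow_order_eq_1[of u] K01 finK a(2) by (simp add: order_def)
    hence "u [^] (p ^ a - 1) = \<one>"
      using G.nat_pow_consistent[where x = u and n = "p ^ a - 1" and H = "?K - {\<zero>}"] by (simp only: nat_pow_mult_of)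
    hence "?n dvd p ^ a - 1" using u(2) by simp
    hence "a = m" using prim[of a] a1 a(1) by force
    thus "?K = carrier R"
      using a(2) p(3) sub fin card_subset_eq by metis
  qed
qed

end

section \<open>Fields whose unit power graph is a directed cycle\<close>

context field begin

lemma additive_order_one_of_prime_card:
  assumes p: "prime (card (carrier R))"
  shows "add.ord \<one> = card (carrier R)"
proof -
  have "add.ord \<one> dvd card (carrier R)"
    using add.ord_dvd_group_order[of \<one>] by (simp add: order_def)
  moreover have "add.ord \<one> \<noteq> 1"
    using add.ord_eq_1[of \<one>] by simp
  ultimately show ?thesis
    using p by (auto simp: prime_nat_iff)
qed

lemma finite_of_prime_card:
  assumes "prime (card (carrier R))"
  shows "finite (carrier R)"
  using assms card.infinite not_prime_0 by metis

text \<open>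
  For the connection set \<open>{1}\<close>, any isomorphism of additive groups that preserves \<open>1\<close> is an
  isomorphism of Cayley digraphs; over a prime field, the multiples of \<open>1\<close> provide one.
\<close>

lemma digraph_iso_prime_field:
  assumes p: "prime (card (carrier R))"
  shows "digraph_iso (cayley_digraph (add_monoid (residue_ring (int (card (carrier R))))) {1})
    (cayley_digraph (add_monoid R) {\<one>})"
proof -
  let ?p = "card (carrier R)"
  interpret Z: residues_prime ?p "residue_ring (int ?p)"
    by unfold_locales (use p in auto)
  let ?Z = "residue_ring (int ?p)"
  have fin: "finite (carrier R)" by (rule finite_of_prime_card[OF p])
  let ?f = "\<lambda>z::int. [z] \<cdot> \<one>"
  have f_eq_iff: "?f z = ?f w \<longleftrightarrow> int ?p dvd w - z" for z w
    using add.int_pow_eq[of \<one> z w] by (simp add: add_pow_def additive_order_one_of_prime_card[OF p])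
  show ?thesis
  proof (rule digraph_iso_cayley_digraphI)
    have inj: "inj_on ?f (carrier ?Z)"
    proof (rule inj_onI)
      fix z w assume "z \<in> carrier ?Z" "w \<in> carrier ?Z" "?f z = ?f w"
      hence "int ?p dvd w - z" "\<bar>w - z\<bar> < int ?p"
        by (auto simp: f_eq_iff Z.res_carrier_eq)
      thus "z = w"
        using dvd_imp_le_int[of "w - z" "int ?p"] by auto
    qed
    have "?f ` carrier ?Z = carrier R"
      by (rule card_subset_eq[OF fin])
         (use inj in \<open>auto simp: card_image Z.res_carrier_eq\<close>)
    with inj show "bij_betw ?f (carrier (add_monoid ?Z)) (carrier (add_monoid R))"
      by (simp add: bij_betw_def)
  next
    fix v w
    assume "v \<in> carrier (add_monoid ?Z)" "w \<in> carrier (add_monoid ?Z)"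
    hence v: "v mod int ?p = v" and w: "w mod int ?p = w"
      by (auto simp: Z.res_carrier_eq)
    have "w \<otimes>\<^bsub>add_monoid ?Z\<^esub> inv\<^bsub>add_monoid ?Z\<^esub> v = (w - v) mod int ?p"
      using Z.res_neg_eq[of v] Z.res_add_eq[of w] by (simp add: a_inv_def mod_simps)
    moreover have "(w - v) mod int ?p = 1 \<longleftrightarrow> int ?p dvd 1 - (w - v)"
      using prime_gt_1_nat[OF p] by (subst mod_eq_dvd_iff[symmetric]) (auto simp: eq_commute[of 1] mod_eq_dvd_iff)
    moreover have "?f w \<otimes>\<^bsub>add_monoid R\<^esub> inv\<^bsub>add_monoid R\<^esub> ?f v = ?f (w - v)"
      using add.int_pow_diff[of \<one> w v] by (simp add: add_pow_def a_inv_def)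
    moreover have "?f (w - v) = \<one> \<longleftrightarrow> int ?p dvd 1 - (w - v)"
      using f_eq_iff[of "w - v" 1] by simp
    ultimately show "w \<otimes>\<^bsub>add_monoid ?Z\<^esub> inv\<^bsub>add_monoid ?Z\<^esub> v \<in> {1}
        \<longleftrightarrow> ?f w \<otimes>\<^bsub>add_monoid R\<^esub> inv\<^bsub>add_monoid R\<^esub> ?f v \<in> {\<one>}"
      by simp
  qed
qed

end

text \<open>
  Fermat's little theorem, so \<open>\<Gamma>(p - 1, p)\<close> is the Cayley digraph with connection set \<open>{1}\<close>,
  a directed cycle of length \<open>p\<close>.
\<close>

lemma unit_powers_residue_ring_prime:
  assumes p: "prime p"
  shows "unit_powers (residue_ring (int p)) (p - 1) = {1}"
proof -
  interpret Z: residues_prime p "residue_ring (int p)"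
    by unfold_locales (use p in auto)
  have "card (carrier (residue_ring (int p))) = p"
    by (simp add: Z.res_carrier_eq)
  thus ?thesis
    using Z.unit_powers_trivial_iff[of "p - 1"] prime_gt_1_nat[OF p] by (simp add: Z.res_one_eq)
qed

text \<open>
  Being isomorphic to \<open>\<Gamma>(p - 1, p)\<close> is a numerical condition: the number of vertices gives the order
  of the field, and the number of arcs then shows that there is a single \<open>k\<close>-th power.
\<close>

lemma (in field) digraph_iso_paley_graph_prime_iff:
  assumes fin: "finite (carrier R)" and p: "prime p"
  shows "digraph_iso (unit_power_graph R k) (paley_graph_prime (p - 1) p) \<longleftrightarrow>
    card (carrier R) = p \<and> unit_powers R k = {\<one>}" (is "?iso \<longleftrightarrow> ?rhs")
    and "digraph_iso (paley_graph_prime (p - 1) p) (unit_power_graph R k) \<longleftrightarrow>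
    card (carrier R) = p \<and> unit_powers R k = {\<one>}" (is "?osi \<longleftrightarrow> ?rhs")
proof -
  let ?Z = "residue_ring (int p)"
  interpret Z: residues_prime p ?Z
    by unfold_locales (use p in auto)
  have paley: "paley_graph_prime (p - 1) p = cayley_digraph (add_monoid ?Z) {1}"
    by (simp only: paley_graph_prime_def unit_power_graph_def unit_powers_residue_ring_prime[OF p])
  have "?osi" if ?rhs
    using digraph_iso_prime_field that p unfolding paley by (auto simp: unit_power_graph_def)
  moreover have "?osi \<longleftrightarrow> ?iso"
    unfolding paley unit_power_graph_def
    using digraph_iso_swap wf_cayley_digraph by metis
  moreover have ?rhs if ?iso
  proof -
    have "card (arcs (paley_graph_prime (p - 1) p)) = p * 1"
      unfolding paley by (subst card_arcs_cayley_digraph)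
        (use Z.add.comm_group_axioms prime_gt_1_nat[OF p] in \<open>auto simp: Z.res_carrier_eq\<close>)
    moreover have "card (arcs (unit_power_graph R k)) = card (carrier R) * card (unit_powers R k)"
      unfolding unit_power_graph_def
      by (subst card_arcs_cayley_digraph) (use add.comm_group_axioms unit_powers_closed in auto)
    moreover have q: "card (carrier R) = p"
      using digraph_iso_card(1)[OF that] unfolding paley unit_power_graph_def
      by (simp add: Z.res_carrier_eq)
    ultimately have "card (unit_powers R k) = 1"
      using digraph_iso_card(2)[OF that] prime_gt_0_nat[OF p] by simp
    thus ?rhs
      using q one_in_unit_powers[of k] by (metis card_1_singletonE singletonD)
  qed
  ultimately show "?iso \<longleftrightarrow> ?rhs" "?osi \<longleftrightarrow> ?rhs" by blast+
qed

section \<open>Reduction to the residue fields\<close>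

text \<open>
  Inverting \<open>k\<close> modulo the order of the subgroup yields \<open>k\<close>-th roots.
\<close>

lemma (in comm_group) coprime_power_surj:
  assumes H: "subgroup H G" and fin: "finite H" and k: "coprime k (card H)" and x: "x \<in> H"
  shows "\<exists>y\<in>H. x = y [^] (k::nat)"
proof -
  interpret H: group "G \<lparr>carrier := H\<rparr>"
    using subgroup.subgroup_is_group[OF H group_axioms] .
  have xG: "x \<in> carrier G" using x subgroup.subset[OF H] by auto
  have "x [^]\<^bsub>G \<lparr>carrier := H\<rparr>\<^esub> card H = \<one>"
    using H.pow_order_eq_1[of x] x by (simp add: order_def)
  hence 1: "x [^] card H = \<one>"
    using nat_pow_consistent[where x = x and n = "card H" and H = H] by simp
  obtain a where "[k * a = 1] (mod card H)"
    using cong_solve_coprime_nat[OF k] by auto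
  hence "[int (k * a) = 1] (mod int (card H))"
    by (metis cong_int_iff of_nat_1)
  moreover have "int (ord x) dvd int (card H)"
    using 1 pow_eq_id[OF xG] by simp
  ultimately have "int (ord x) dvd 1 - int (k * a)"
    by (metis cong_iff_dvd_diff cong_sym dvd_trans)
  hence "x [^] int (k * a) = x [^] (1::int)"
    using int_pow_eq[OF xG] by metis
  hence "x [^] (k * a) = x"
    using xG by (metis int_pow_int int_pow_1)
  hence "x = (x [^] a) [^] k"
    using xG by (simp add: nat_pow_pow mult.commute)
  moreover have "x [^] a \<in> H"
    by (induction a) (use x subgroup.one_closed[OF H] subgroup.m_closed[OF H] in auto)
  ultimately show ?thesis by blast
qed

lemma (in ring_hom_cring) hom_Units:
  assumes "x \<in> Units R"
  shows "h x \<in> Units S"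
proof -
  obtain y where "y \<in> carrier R" "x \<otimes> y = \<one>"
    using assms unfolding Units_def by auto
  moreover have "x \<in> carrier R" using assms by auto
  ultimately have "h x \<otimes>\<^bsub>S\<^esub> h y = \<one>\<^bsub>S\<^esub>" "h x \<in> carrier S" "h y \<in> carrier S"
    by (auto simp flip: hom_mult)
  thus ?thesis
    unfolding Units_def using S.m_comm[of "h x" "h y"] by auto
qed

lemma (in ring_hom_cring) hom_nat_pow:
  assumes "x \<in> carrier R"
  shows "h (x [^] (n::nat)) = h x [^]\<^bsub>S\<^esub> n"
  by (induction n) (use assms in auto)

lemma (in ring_hom_cring) hom_add_nat_pow:
  assumes "x \<in> carrier R"
  shows "h ([(n::nat)] \<cdot> x) = [n] \<cdot>\<^bsub>S\<^esub> h x"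
  by (induction n) (use assms in auto)

text \<open>
  A finite commutative ring seen through its residue fields. Joint surjectivity is the Chinese
  remainder theorem, and the last assumption says that the common kernel of the maps \<open>\<pi> i\<close> is
  contained in the Jacobson radical.
\<close>

locale residue_field_decomposition = cring R for R :: "('a, 'm) ring_scheme" (structure) +
  fixes F :: "nat \<Rightarrow> ('b, 'n) ring_scheme" and \<pi> :: "nat \<Rightarrow> 'a \<Rightarrow> 'b" and s :: nat
  assumes finite_carrier: "finite (carrier R)"
    and field: "i < s \<Longrightarrow> field (F i)"
    and hom: "i < s \<Longrightarrow> \<pi> i \<in> ring_hom R (F i)"
    and surj: "(\<And>i. i < s \<Longrightarrow> y i \<in> carrier (F i)) \<Longrightarrow> \<exists>x\<in>carrier R. \<forall>i<s. \<pi> i x = y i"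
    and unitI: "x \<in> carrier R \<Longrightarrow> (\<And>i. i < s \<Longrightarrow> \<pi> i x \<noteq> \<zero>\<^bsub>F i\<^esub>) \<Longrightarrow> x \<in> Units R"
begin

lemma ring_hom_cring_\<pi>:
  assumes "i < s"
  shows "ring_hom_cring R (F i) (\<pi> i)"
proof -
  interpret Fi: field "F i" by (rule field[OF assms])
  show ?thesis by unfold_locales (rule hom[OF assms])
qed

lemma \<pi>_image: 
  assumes i: "i < s"
  shows "\<pi> i ` carrier R = carrier (F i)"
proof -
  interpret h: ring_hom_cring R "F i" "\<pi> i" by (rule ring_hom_cring_\<pi>[OF i])
  have "y \<in> \<pi> i ` carrier R" if "y \<in> carrier (F i)" for y
  proof -
    define v where "v = (\<lambda>j. if j = i then y else \<zero>\<^bsub>F j\<^esub>)"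
    have "v j \<in> carrier (F j)" if "j < s" for j
      using \<open>y \<in> carrier (F i)\<close> ring_hom_cring_\<pi>[OF that]
      by (auto simp: v_def intro!: ring.ring_simprules(2) cring.axioms(1) ring_hom_cring.axioms(2))
    from surj[of v, OF this] obtain x where "x \<in> carrier R" "\<forall>j<s. \<pi> j x = v j" by blast
    thus ?thesis using i by (auto simp: v_def intro!: image_eqI[of _ _ x])
  qed
  thus ?thesis by auto
qed

lemma finite_residue_field: "i < s \<Longrightarrow> finite (carrier (F i))"
  using \<pi>_image finite_carrier by (metis finite_imageI)

lemma unit_lift:
  assumes i: "i < s" and v: "v \<in> Units (F i)"
  obtains x where "x \<in> Units R" "\<pi> i x = v" "\<And>j. j < s \<Longrightarrow> j \<noteq> i \<Longrightarrow> \<pi> j x = \<one>\<^bsub>F j\<^esub>"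
proof -
  define y where "y = (\<lambda>j. if j = i then v else \<one>\<^bsub>F j\<^esub>)"
  have y: "y j \<in> carrier (F j)" "y j \<noteq> \<zero>\<^bsub>F j\<^esub>" if j: "j < s" for j
  proof -
    interpret Fj: field "F j" by (rule field[OF j])
    show "y j \<in> carrier (F j)" "y j \<noteq> \<zero>\<^bsub>F j\<^esub>"
      using v field.field_Units[OF field[OF i]] by (auto simp: y_def)
  qed
  obtain x where x: "x \<in> carrier R" "\<forall>j<s. \<pi> j x = y j"
    using surj[of y] y by blast
  show thesis
    by (rule that[of x]) (use x y unitI i in \<open>auto simp: y_def\<close>)
qed

lemma unit_power_lift:
  assumes i: "i < s" and u: "u \<in> unit_powers (F i) k"
  obtains x where "x \<in> unit_powers R k" "\<pi> i x = u" "\<And>j. j < s \<Longrightarrow> j \<noteq> i \<Longrightarrow> \<pi> j x = \<one>\<^bsub>F j\<^esub>"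
proof -
  obtain v where v: "v \<in> Units (F i)" "u = v [^]\<^bsub>F i\<^esub> k"
    using u by (auto simp: unit_powers_def)
  obtain x where x: "x \<in> Units R" "\<pi> i x = v" "\<And>j. j < s \<Longrightarrow> j \<noteq> i \<Longrightarrow> \<pi> j x = \<one>\<^bsub>F j\<^esub>"
    using unit_lift[OF i v(1)] by metis
  have pow: "\<pi> j (x [^] k) = \<pi> j x [^]\<^bsub>F j\<^esub> k" if "j < s" for j
    using ring_hom_cring.hom_nat_pow[OF ring_hom_cring_\<pi>[OF that]] x(1) by auto
  show thesis
  proof (rule that[of "x [^] k"])
    show "x [^] k \<in> unit_powers R k" using x(1) by (auto simp: unit_powers_def)
    show "\<pi> i (x [^] k) = u" using pow[OF i] x v by simp
    fix j assume j: "j < s" "j \<noteq> i"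
    interpret Fj: field "F j" by (rule field[OF j(1)])
    show "\<pi> j (x [^] k) = \<one>\<^bsub>F j\<^esub>" using pow[OF j(1)] x(3)[OF j] by simp
  qed
qed

lemma \<pi>_image_unit_powers:
  assumes i: "i < s"
  shows "\<pi> i ` unit_powers R k = unit_powers (F i) k"
proof
  interpret h: ring_hom_cring R "F i" "\<pi> i" by (rule ring_hom_cring_\<pi>[OF i])
  show "\<pi> i ` unit_powers R k \<subseteq> unit_powers (F i) k"
    using h.hom_Units by (force simp: unit_powers_def h.hom_nat_pow Units_closed)
  show "unit_powers (F i) k \<subseteq> \<pi> i ` unit_powers R k"
    using unit_power_lift[OF i] by (metis imageI subsetI)
qed

lemma \<pi>_image_unit_power_span:
  assumes i: "i < s"
  shows "\<pi> i ` unit_power_span R k = unit_power_span (F i) k"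
proof -
  interpret h: ring_hom_cring R "F i" "\<pi> i" by (rule ring_hom_cring_\<pi>[OF i])
  have "group_hom (add_monoid R) (add_monoid (F i)) (\<pi> i)"
    by unfold_locales (auto simp: hom_def)
  from group_hom.generate_img[OF this, of "unit_powers R k"] show ?thesis
    using unit_powers_closed[of k] by (simp add: unit_power_span_def \<pi>_image_unit_powers[OF i])
qed

definition radical :: "'a set" where
  "radical = {x \<in> carrier R. \<forall>i<s. \<pi> i x = \<zero>\<^bsub>F i\<^esub>}"

lemma subgroup_radical: "subgroup radical (add_monoid R)"
proof (rule add.finite_submonoid_is_subgroup)
  have "\<pi> i \<zero> = \<zero>\<^bsub>F i\<^esub>" if "i < s" for i
    using ring_hom_cring.hom_zero[OF ring_hom_cring_\<pi>[OF that]] .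
  thus "\<zero> \<in> radical" by (simp add: radical_def)
  fix x y assume xy: "x \<in> radical" "y \<in> radical"
  have "\<pi> i (x \<oplus> y) = \<zero>\<^bsub>F i\<^esub>" if i: "i < s" for i
  proof -
    interpret h: ring_hom_cring R "F i" "\<pi> i" by (rule ring_hom_cring_\<pi>[OF i])
    show ?thesis using xy i by (auto simp: radical_def)
  qed
  thus "x \<oplus> y \<in> radical" using xy by (auto simp: radical_def)
qed (use finite_carrier in \<open>auto simp: radical_def\<close>)

text \<open>
  This is where coprimality of \<open>k\<close> and the order of the ring enters: \<open>1 + radical\<close> is a group under
  multiplication, and it has as many elements as the radical, whose order divides that of the
  ring. So every element of this group has a \<open>k\<close>-th root in it.
\<close>

lemma one_plus_radical_unit_power:
  assumes k: "coprime k (card (carrier R))" and x: "x \<in> radical"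
  shows "\<one> \<oplus> x \<in> unit_powers R k"
proof -
  let ?V = "(\<lambda>x. \<one> \<oplus> x) ` radical"
  have rad: "radical \<subseteq> carrier R" by (auto simp: radical_def)
  have fin: "finite radical" using rad finite_carrier finite_subset by blast
  interpret U: comm_group "units_of R" by (rule units_comm_group)
  \<comment> \<open>The fibre of the residue maps over one; in this form closure under products is immediate.\<close>
  have V: "?V = {v \<in> carrier R. \<forall>i<s. \<pi> i v = \<one>\<^bsub>F i\<^esub>}"
  proof
    show "?V \<subseteq> {v \<in> carrier R. \<forall>i<s. \<pi> i v = \<one>\<^bsub>F i\<^esub>}"
    proof clarify
      fix x assume x: "x \<in> radical"
      have "\<pi> i (\<one> \<oplus> x) = \<one>\<^bsub>F i\<^esub>" if i: "i < s" for i
      proof -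
        interpret h: ring_hom_cring R "F i" "\<pi> i" by (rule ring_hom_cring_\<pi>[OF i])
        show ?thesis using x i by (auto simp: radical_def)
      qed
      thus "\<one> \<oplus> x \<in> carrier R \<and> (\<forall>i<s. \<pi> i (\<one> \<oplus> x) = \<one>\<^bsub>F i\<^esub>)"
        using x by (auto simp: radical_def)
    qed
    show "{v \<in> carrier R. \<forall>i<s. \<pi> i v = \<one>\<^bsub>F i\<^esub>} \<subseteq> ?V"
    proof
      fix v assume v: "v \<in> {v \<in> carrier R. \<forall>i<s. \<pi> i v = \<one>\<^bsub>F i\<^esub>}"
      have "\<pi> i (v \<ominus> \<one>) = \<zero>\<^bsub>F i\<^esub>" if i: "i < s" for i
      proof -
        interpret h: ring_hom_cring R "F i" "\<pi> i" by (rule ring_hom_cring_\<pi>[OF i])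
        show ?thesis using v i by (auto simp: h.hom_sub)
      qed
      hence "v \<ominus> \<one> \<in> radical" using v by (auto simp: radical_def)
      moreover have "v = \<one> \<oplus> (v \<ominus> \<one>)" using v by (simp add: a_minus_def a_lcomm r_neg)
      ultimately show "v \<in> ?V" by blast
    qed
  qed
  have V_units: "?V \<subseteq> carrier (units_of R)"
  proof
    fix v assume "v \<in> ?V"
    hence v: "v \<in> carrier R" "\<And>i. i < s \<Longrightarrow> \<pi> i v = \<one>\<^bsub>F i\<^esub>" using V by auto
    have "\<one>\<^bsub>F i\<^esub> \<noteq> \<zero>\<^bsub>F i\<^esub>" if "i < s" for i
      using field[OF that] field.axioms(1) domain.one_not_zero by blast
    thus "v \<in> carrier (units_of R)"
      using unitI[OF v(1)] v(2) by (simp add: units_of_carrier)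
  qed
  have "\<pi> i \<one> = \<one>\<^bsub>F i\<^esub>" if "i < s" for i
    by (rule ring_hom_one[OF hom[OF that]])
  moreover have "\<pi> i (v \<otimes> w) = \<one>\<^bsub>F i\<^esub>" if "v \<in> ?V" "w \<in> ?V" and i: "i < s" for v w i
  proof -
    interpret h: ring_hom_cring R "F i" "\<pi> i" by (rule ring_hom_cring_\<pi>[OF i])
    show ?thesis using that unfolding V by auto
  qed
  ultimately have sub: "subgroup ?V (units_of R)"
    using V_units finite_carrier fin
    by (intro U.finite_submonoid_is_subgroup) (auto simp: V units_of_def finite_ring_finite_units)
  have "card ?V = card radical"
    by (intro card_image inj_onI) (use rad in \<open>auto simp: subset_iff\<close>)
  moreover have "card radical dvd card (carrier R)"
    using add.lagrange[OF subgroup_radical] by (simp add: order_def) (metis dvd_triv_right)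
  ultimately have "coprime k (card ?V)"
    using k by (metis coprime_divisors dvd_refl)
  moreover have "\<one> \<oplus> x \<in> ?V" using x by blast
  ultimately obtain y where y: "y \<in> ?V" "\<one> \<oplus> x = y [^]\<^bsub>units_of R\<^esub> k"
    using U.coprime_power_surj[OF sub] fin by blast
  have "y \<in> Units R" using y(1) V_units by (metis subsetD units_of_carrier)
  moreover have "\<one> \<oplus> x = y [^] k" using y(2) units_of_pow[OF calculation] by simp
  ultimately show ?thesis
    unfolding unit_powers_def by blast
qed

text \<open>
  An element \<open>x\<close> of the radical is the difference of the two unit powers \<open>1 + x\<close> and \<open>1\<close>. Hence
  membership in the span can be decided on the residue fields.
\<close>

lemma radical_subset_span:
  assumes k: "coprime k (card (carrier R))"
  shows "radical \<subseteq> unit_power_span R k"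
proof
  fix x assume x: "x \<in> radical"
  interpret K: subgroup "unit_power_span R k" "add_monoid R" by (rule subgroup_unit_power_span)
  have "\<one> \<in> unit_power_span R k" "\<one> \<oplus> x \<in> unit_power_span R k"
    using one_plus_radical_unit_power[OF k x] one_in_unit_powers unit_powers_subset_span by blast+
  hence "\<ominus> \<one> \<oplus> (\<one> \<oplus> x) \<in> unit_power_span R k"
    using K.m_closed K.m_inv_closed by (simp add: a_inv_def)
  moreover have "\<ominus> \<one> \<oplus> (\<one> \<oplus> x) = x"
    using x by (simp add: radical_def a_assoc[symmetric] l_neg)
  ultimately show "x \<in> unit_power_span R k" by simp
qed

end

section \<open>Separating the residue fields\<close>

text \<open>
  A full span with a single \<open>k\<close>-th power forces a prime field: \<open>1\<close> divides \<open>p - 1\<close>, so it is a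
  primitive divisor only for exponent one.
\<close>

lemma prime_of_primitive_divisor_one:
  assumes "primitive_divisor 1 q"
  shows "prime q"
proof -
  obtain p m where p: "prime p" "1 \<le> m" "q = p ^ m" and m: "\<forall>a. 1 \<le> a \<and> a < m \<longrightarrow> \<not> 1 dvd p ^ a - 1"
    using assms unfolding primitive_divisor_def by blast
  have "\<not> 1 < m" using m by force
  hence "m = 1" using p(2) by simp
  thus ?thesis using p by simp
qed

context residue_field_decomposition begin

lemma \<pi>_span_surj:
  assumes "i < s" and "unit_power_span (F i) k = carrier (F i)" and "y \<in> carrier (F i)"
  obtains x where "x \<in> unit_power_span R k" "\<pi> i x = y"
  using \<pi>_image_unit_power_span[OF assms(1), of k] assms(2,3) by (metis imageE)

text \<open>
  If \<open>u \<noteq> 1\<close> is a \<open>k\<close>-th power in the field \<open>F i\<close>, lift it to a unit power \<open>x\<close> that is \<open>1\<close> in all other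
  residue fields. The difference \<open>x - 1\<close> then lives in the \<open>i\<close>-th coordinate only, and it can be
  rescaled to \<open>1\<close> there by an element of the span.
\<close>

lemma unit_power_span_isolate:
  assumes i: "i < s" and U: "unit_powers (F i) k \<noteq> {\<one>\<^bsub>F i\<^esub>}"
    and full: "unit_power_span (F i) k = carrier (F i)"
  obtains e where "e \<in> unit_power_span R k" "\<pi> i e = \<one>\<^bsub>F i\<^esub>"
    "\<And>j. j < s \<Longrightarrow> j \<noteq> i \<Longrightarrow> \<pi> j e = \<zero>\<^bsub>F j\<^esub>"
proof -
  let ?K = "unit_power_span R k"
  note K = subringE[OF subring_unit_power_span[of k]]
  interpret Fi: field "F i" by (rule field[OF i])
  interpret h: ring_hom_cring R "F i" "\<pi> i" by (rule ring_hom_cring_\<pi>[OF i])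
  obtain u where u: "u \<in> unit_powers (F i) k" "u \<noteq> \<one>\<^bsub>F i\<^esub>"
    using U Fi.one_in_unit_powers[of k] by auto
  obtain x where x: "x \<in> unit_powers R k" "\<pi> i x = u"
    "\<And>j. j < s \<Longrightarrow> j \<noteq> i \<Longrightarrow> \<pi> j x = \<one>\<^bsub>F j\<^esub>"
    using unit_power_lift[OF i u(1)] by metis
  have uc: "u \<in> carrier (F i)" using u(1) Fi.unit_powers_closed by auto
  have xK: "x \<in> ?K" using x(1) unit_powers_subset_span by auto
  have xc: "x \<in> carrier R" using xK K(1) by auto
  define d where "d = x \<ominus> \<one>"
  have dK: "d \<in> ?K"
    using xK K(3,5,7) by (simp add: d_def a_minus_def)
  have dc: "d \<in> carrier R" using dK K(1) by auto
  have di: "\<pi> i d = u \<ominus>\<^bsub>F i\<^esub> \<one>\<^bsub>F i\<^esub>"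
    using xc x(2) by (simp add: d_def h.hom_sub)
  have "\<pi> i d \<in> Units (F i)"
    unfolding di using uc u(2) by (simp add: Fi.field_Units)
  then obtain v where v: "v \<in> carrier (F i)" "v \<otimes>\<^bsub>F i\<^esub> \<pi> i d = \<one>\<^bsub>F i\<^esub>"
    by (auto simp: Units_def)
  obtain c where c: "c \<in> ?K" "\<pi> i c = v"
    by (rule \<pi>_span_surj[OF i full v(1)])
  have cc: "c \<in> carrier R" using c K(1) by auto
  show thesis
  proof (rule that[of "c \<otimes> d"])
    show "c \<otimes> d \<in> ?K" using c dK K(6) by auto
    show "\<pi> i (c \<otimes> d) = \<one>\<^bsub>F i\<^esub>" using cc dc c(2) v(2) by simp
    fix j assume j: "j < s" "j \<noteq> i"
    interpret g: ring_hom_cring R "F j" "\<pi> j" by (rule ring_hom_cring_\<pi>[OF j(1)])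
    have "\<pi> j d = \<zero>\<^bsub>F j\<^esub>"
      using xc x(3)[OF j] by (simp add: d_def g.hom_sub)
    thus "\<pi> j (c \<otimes> d) = \<zero>\<^bsub>F j\<^esub>" using cc dc by simp
  qed
qed

text \<open>
  A nontrivial \<open>k\<close>-th power in either of the two fields allows one coordinate to be isolated from the
  other; without one, they are told apart by an integer multiple of \<open>1\<close> if their orders are coprime.
\<close>

lemma unit_power_span_separate:
  assumes i: "i < s" and j: "j < s" and ij: "i \<noteq> j"
    and full: "\<And>i. i < s \<Longrightarrow> unit_power_span (F i) k = carrier (F i)"
    and sep: "unit_powers (F i) k \<noteq> {\<one>\<^bsub>F i\<^esub>} \<or> unit_powers (F j) k \<noteq> {\<one>\<^bsub>F j\<^esub>} \<or>
      coprime (card (carrier (F i))) (card (carrier (F j)))"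
  shows "\<exists>w\<in>unit_power_span R k. \<pi> i w \<noteq> \<zero>\<^bsub>F i\<^esub> \<and> \<pi> j w = \<zero>\<^bsub>F j\<^esub>"
proof -
  let ?K = "unit_power_span R k"
  note K = subringE[OF subring_unit_power_span[of k]]
  interpret Fi: field "F i" by (rule field[OF i])
  interpret Fj: field "F j" by (rule field[OF j])
  interpret h: ring_hom_cring R "F i" "\<pi> i" by (rule ring_hom_cring_\<pi>[OF i])
  interpret g: ring_hom_cring R "F j" "\<pi> j" by (rule ring_hom_cring_\<pi>[OF j])
  consider "unit_powers (F i) k \<noteq> {\<one>\<^bsub>F i\<^esub>}" | "unit_powers (F j) k \<noteq> {\<one>\<^bsub>F j\<^esub>}"
    | "coprime (card (carrier (F i))) (card (carrier (F j)))"
    using sep by blast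
  thus ?thesis
  proof cases
    case 1
    obtain e where e: "e \<in> ?K" "\<pi> i e = \<one>\<^bsub>F i\<^esub>" "\<And>j. j < s \<Longrightarrow> j \<noteq> i \<Longrightarrow> \<pi> j e = \<zero>\<^bsub>F j\<^esub>"
      using unit_power_span_isolate[OF i 1 full[OF i]] by metis
    show ?thesis using e(1,2) e(3)[OF j] ij by (intro bexI[of _ e]) auto
  next
    case 2
    obtain e where e: "e \<in> ?K" "\<pi> j e = \<one>\<^bsub>F j\<^esub>" "\<And>i. i < s \<Longrightarrow> i \<noteq> j \<Longrightarrow> \<pi> i e = \<zero>\<^bsub>F i\<^esub>"
      using unit_power_span_isolate[OF j 2 full[OF j]] by metis
    have ec: "e \<in> carrier R" using e K(1) by auto
    have "\<one> \<ominus> e \<in> ?K" using e K(3,5,7) by (simp add: a_minus_def)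
    moreover have "\<pi> i (\<one> \<ominus> e) \<noteq> \<zero>\<^bsub>F i\<^esub>" "\<pi> j (\<one> \<ominus> e) = \<zero>\<^bsub>F j\<^esub>"
      using ec e(2) e(3)[OF i ij] by (simp_all add: h.hom_sub g.hom_sub)
    ultimately show ?thesis by blast
  next
    case 3
    let ?q = "card (carrier (F j))"
    have "[n] \<cdot> \<one> \<in> ?K" for n :: nat
      by (induction n) (use K(2,3,7) in auto)
    hence "[?q] \<cdot> \<one> \<in> ?K" .
    moreover have "\<pi> j ([?q] \<cdot> \<one>) = \<zero>\<^bsub>F j\<^esub>"
      using Fj.add.pow_order_eq_1[of "\<one>\<^bsub>F j\<^esub>"] g.hom_add_nat_pow[of \<one> ?q]
      by (simp add: add_pow_def order_def)
    moreover have "\<pi> i ([?q] \<cdot> \<one>) \<noteq> \<zero>\<^bsub>F i\<^esub>"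
    proof
      assume "\<pi> i ([?q] \<cdot> \<one>) = \<zero>\<^bsub>F i\<^esub>"
      hence "Fi.add.ord \<one>\<^bsub>F i\<^esub> dvd ?q"
        using h.hom_add_nat_pow[of \<one> ?q] Fi.add.pow_eq_id[of "\<one>\<^bsub>F i\<^esub>" ?q]
        by (simp add: add_pow_def)
      moreover have "Fi.add.ord \<one>\<^bsub>F i\<^esub> dvd card (carrier (F i))"
        using Fi.add.ord_dvd_group_order[of "\<one>\<^bsub>F i\<^esub>"] by (simp add: order_def)
      ultimately have "Fi.add.ord \<one>\<^bsub>F i\<^esub> = 1"
        using 3 coprime_common_divisor_nat by blast
      thus False
        using Fi.add.ord_eq_1[of "\<one>\<^bsub>F i\<^esub>"] by simp
    qed
    ultimately show ?thesis by blast
  qed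
qed

text \<open>
  Multiplying the pairwise separating elements isolates one coordinate from all the others; the
  product stays nonzero at \<open>i\<close> because \<open>F i\<close> is a field. The factors are collected one index at a
  time.
\<close>

lemma unit_power_span_isolate_below:
  assumes i: "i < s"
    and sep: "\<And>j. j < s \<Longrightarrow> i \<noteq> j \<Longrightarrow> \<exists>w\<in>unit_power_span R k. \<pi> i w \<noteq> \<zero>\<^bsub>F i\<^esub> \<and> \<pi> j w = \<zero>\<^bsub>F j\<^esub>"
    and t: "t \<le> s"
  shows "\<exists>w\<in>unit_power_span R k. \<pi> i w \<noteq> \<zero>\<^bsub>F i\<^esub> \<and> (\<forall>j<t. j \<noteq> i \<longrightarrow> \<pi> j w = \<zero>\<^bsub>F j\<^esub>)"
  using t
proof (induction t)
  note K = subringE[OF subring_unit_power_span[of k]]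
  interpret Fi: field "F i" by (rule field[OF i])
  interpret h: ring_hom_cring R "F i" "\<pi> i" by (rule ring_hom_cring_\<pi>[OF i])
  {
    case 0
    show ?case using K(3) h.hom_one Fi.one_not_zero by (intro bexI[of _ \<one>]) auto
  next
    case (Suc t)
    then obtain w where w: "w \<in> unit_power_span R k" "\<pi> i w \<noteq> \<zero>\<^bsub>F i\<^esub>"
      "\<And>j. j < t \<Longrightarrow> j \<noteq> i \<Longrightarrow> \<pi> j w = \<zero>\<^bsub>F j\<^esub>"
      by auto
    show ?case
    proof (cases "t = i")
      case True
      thus ?thesis using w by (intro bexI[of _ w]) (auto simp: less_Suc_eq)
    next
      case False
      obtain z where z: "z \<in> unit_power_span R k" "\<pi> i z \<noteq> \<zero>\<^bsub>F i\<^esub>" "\<pi> t z = \<zero>\<^bsub>F t\<^esub>"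
        using sep[of t] False Suc.prems by auto
      have c: "w \<in> carrier R" "z \<in> carrier R" using w z K(1) by auto
      have "\<pi> i (w \<otimes> z) \<noteq> \<zero>\<^bsub>F i\<^esub>"
        using w(2) z(2) c Fi.integral[of "\<pi> i w" "\<pi> i z"] by auto
      moreover have "\<pi> j (w \<otimes> z) = \<zero>\<^bsub>F j\<^esub>" if j: "j < Suc t" "j \<noteq> i" for j
      proof -
        have "j < s" using j Suc.prems by simp
        then interpret g: ring_hom_cring R "F j" "\<pi> j" by (rule ring_hom_cring_\<pi>)
        have "\<pi> j w = \<zero>\<^bsub>F j\<^esub> \<or> \<pi> j z = \<zero>\<^bsub>F j\<^esub>"
          using w(3)[of j] z(3) j by (cases "j = t") auto
        thus ?thesis using c by auto
      qed
      ultimately show ?thesis using K(6) w(1) z(1) by blast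
    qed
  }
qed

text \<open>
  Elements of the span are subtracted to clear the coordinates of \<open>x\<close> one by one, from the last to
  the first. What remains is in the radical, and so in the span.
\<close>

lemma carrier_subset_unit_power_span:
  assumes k: "coprime k (card (carrier R))"
    and full: "\<And>i. i < s \<Longrightarrow> unit_power_span (F i) k = carrier (F i)"
    and sep: "\<And>i j. i < s \<Longrightarrow> j < s \<Longrightarrow> i \<noteq> j \<Longrightarrow>
      \<exists>w\<in>unit_power_span R k. \<pi> i w \<noteq> \<zero>\<^bsub>F i\<^esub> \<and> \<pi> j w = \<zero>\<^bsub>F j\<^esub>"
  shows "carrier R \<subseteq> unit_power_span R k"
proof -
  let ?K = "unit_power_span R k"
  note K = subringE[OF subring_unit_power_span[of k]]
  have "x \<in> ?K" if "t \<le> s" "x \<in> carrier R" "\<And>i. t \<le> i \<Longrightarrow> i < s \<Longrightarrow> \<pi> i x = \<zero>\<^bsub>F i\<^esub>" for t x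
    using that
  proof (induction t arbitrary: x)
    case 0
    thus ?case using radical_subset_span[OF k] by (auto simp: radical_def)
  next
    case (Suc t)
    hence t: "t < s" by simp
    interpret Ft: field "F t" by (rule field[OF t])
    interpret h: ring_hom_cring R "F t" "\<pi> t" by (rule ring_hom_cring_\<pi>[OF t])
    obtain w where w: "w \<in> ?K" "\<pi> t w \<noteq> \<zero>\<^bsub>F t\<^esub>" "\<And>j. j < s \<Longrightarrow> j \<noteq> t \<Longrightarrow> \<pi> j w = \<zero>\<^bsub>F j\<^esub>"
      using unit_power_span_isolate_below[OF t sep[OF t] le_refl] by metis
    have wc: "w \<in> carrier R" using w K(1) by auto
    have "\<pi> t w \<in> Units (F t)" using w(2) wc by (simp add: Ft.field_Units)
    then obtain v where v: "v \<in> carrier (F t)" "v \<otimes>\<^bsub>F t\<^esub> \<pi> t w = \<one>\<^bsub>F t\<^esub>"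
      by (auto simp: Units_def)
    have "\<pi> t x \<otimes>\<^bsub>F t\<^esub> v \<in> carrier (F t)" using v Suc.prems(2) by simp
    then obtain c where c: "c \<in> ?K" "\<pi> t c = \<pi> t x \<otimes>\<^bsub>F t\<^esub> v"
      by (rule \<pi>_span_surj[OF t full[OF t]])
    have cc: "c \<in> carrier R" using c K(1) by auto
    have "x \<ominus> c \<otimes> w \<in> ?K"
    proof (rule Suc.IH)
      fix i assume i: "t \<le> i" "i < s"
      interpret g: ring_hom_cring R "F i" "\<pi> i" by (rule ring_hom_cring_\<pi>[OF i(2)])
      show "\<pi> i (x \<ominus> c \<otimes> w) = \<zero>\<^bsub>F i\<^esub>"
      proof (cases "i = t")
        case True
        have "\<pi> t (c \<otimes> w) = \<pi> t x"
          using c(2) cc wc v Suc.prems(2) by (simp add: Ft.m_assoc)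
        thus ?thesis using True Suc.prems(2) cc wc by (simp add: h.hom_sub)
      next
        case False
        thus ?thesis
          using Suc.prems(2) Suc.prems(3)[of i] i w(3)[of i] cc wc by (simp add: g.hom_sub)
      qed
    qed (use t Suc.prems(2) cc wc in auto)
    hence "(x \<ominus> c \<otimes> w) \<oplus> c \<otimes> w \<in> ?K"
      using K(6,7) c(1) w(1) by auto
    thus "x \<in> ?K"
      using Suc.prems(2) cc wc by (simp add: a_minus_def a_assoc l_neg)
  qed
  thus ?thesis by force
qed

text \<open>
  If both fields have \<open>p\<close> elements and \<open>1\<close> as their only \<open>k\<close>-th power, then the generators all have the
  coordinates \<open>(1, 1)\<close> at \<open>i\<close> and \<open>j\<close>. The span therefore only reaches the diagonal of
  \<open>F i \<times> F j\<close>, consisting of the multiples of \<open>(1, 1)\<close>, and misses \<open>(0, 1)\<close>.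
\<close>

lemma equal_characteristic_obstruction:
  assumes i: "i < s" and j: "j < s" and ij: "i \<noteq> j" and p: "prime p"
    and qi: "card (carrier (F i)) = p" and Ui: "unit_powers (F i) k = {\<one>\<^bsub>F i\<^esub>}"
    and qj: "card (carrier (F j)) = p" and Uj: "unit_powers (F j) k = {\<one>\<^bsub>F j\<^esub>}"
  shows "unit_power_span R k \<noteq> carrier R"
proof
  assume all: "unit_power_span R k = carrier R"
  interpret Fi: field "F i" by (rule field[OF i])
  interpret Fj: field "F j" by (rule field[OF j])
  interpret h: ring_hom_cring R "F i" "\<pi> i" by (rule ring_hom_cring_\<pi>[OF i])
  interpret g: ring_hom_cring R "F j" "\<pi> j" by (rule ring_hom_cring_\<pi>[OF j])
  let ?D = "{x \<in> carrier R. \<exists>n::nat. \<pi> i x = [n] \<cdot>\<^bsub>F i\<^esub> \<one>\<^bsub>F i\<^esub> \<and> \<pi> j x = [n] \<cdot>\<^bsub>F j\<^esub> \<one>\<^bsub>F j\<^esub>}"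
  have "subgroup ?D (add_monoid R)"
  proof (rule add.finite_submonoid_is_subgroup)
    show "\<zero> \<in> ?D" by (auto intro!: exI[of _ 0])
    fix x y assume x: "x \<in> ?D" and y: "y \<in> ?D"
    then obtain m n :: nat where
      "\<pi> i x = [m] \<cdot>\<^bsub>F i\<^esub> \<one>\<^bsub>F i\<^esub>" "\<pi> j x = [m] \<cdot>\<^bsub>F j\<^esub> \<one>\<^bsub>F j\<^esub>"
      "\<pi> i y = [n] \<cdot>\<^bsub>F i\<^esub> \<one>\<^bsub>F i\<^esub>" "\<pi> j y = [n] \<cdot>\<^bsub>F j\<^esub> \<one>\<^bsub>F j\<^esub>"
      by blast
    thus "x \<oplus> y \<in> ?D"
      using x y by (auto simp: Fi.add.nat_pow_mult Fj.add.nat_pow_mult intro!: exI[of _ "m + n"])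
  qed (use finite_carrier in auto)
  moreover have "unit_powers R k \<subseteq> ?D"
  proof
    fix x assume x: "x \<in> unit_powers R k"
    have "\<pi> i x = \<one>\<^bsub>F i\<^esub>" "\<pi> j x = \<one>\<^bsub>F j\<^esub>"
      using \<pi>_image_unit_powers[OF i, of k] \<pi>_image_unit_powers[OF j, of k] Ui Uj x by auto
    thus "x \<in> ?D"
      using x unit_powers_closed by (auto intro!: exI[of _ 1])
  qed
  ultimately have D: "carrier R \<subseteq> ?D"
    using unit_power_span_least all by blast
  define v where "v = (\<lambda>l. if l = j then \<one>\<^bsub>F l\<^esub> else \<zero>\<^bsub>F l\<^esub>)"
  have "v l \<in> carrier (F l)" if "l < s" for l
  proof -
    interpret Fl: field "F l" by (rule field[OF that])
    show ?thesis by (auto simp: v_def)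
  qed
  then obtain x where x: "x \<in> carrier R" "\<And>l. l < s \<Longrightarrow> \<pi> l x = v l"
    using surj[of v] by blast
  then obtain n :: nat where n: "\<zero>\<^bsub>F i\<^esub> = [n] \<cdot>\<^bsub>F i\<^esub> \<one>\<^bsub>F i\<^esub>" "\<one>\<^bsub>F j\<^esub> = [n] \<cdot>\<^bsub>F j\<^esub> \<one>\<^bsub>F j\<^esub>"
    using D x(2)[OF i] x(2)[OF j] ij by (auto simp: v_def)
  have "p dvd n"
    using n(1) Fi.add.pow_eq_id[of "\<one>\<^bsub>F i\<^esub>" n] Fi.additive_order_one_of_prime_card p qi by (simp add: add_pow_def)
  hence "[n] \<cdot>\<^bsub>F j\<^esub> \<one>\<^bsub>F j\<^esub> = \<zero>\<^bsub>F j\<^esub>"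
    using Fj.add.pow_eq_id[of "\<one>\<^bsub>F j\<^esub>" n] Fj.additive_order_one_of_prime_card p qj by (simp add: add_pow_def)
  thus False using n(2) by simp
qed

text \<open>
  Full spans on the residue fields make a field with a trivial group of \<open>k\<close>-th powers a prime field.
  Prime fields of different orders have coprime orders, so the only pairs of indices that cannot be
  separated are those with the same prime.
\<close>

theorem unit_power_span_eq_carrier_iff:
  assumes k1: "k \<ge> 1" and k: "coprime k (card (carrier R))"
  shows "unit_power_span R k = carrier R \<longleftrightarrow>
    (\<forall>i<s. unit_power_span (F i) k = carrier (F i)) \<and>
    \<not> (\<exists>i<s. \<exists>j<s. i \<noteq> j \<and> (\<exists>p. prime p \<and>
         (card (carrier (F i)) = p \<and> unit_powers (F i) k = {\<one>\<^bsub>F i\<^esub>}) \<and>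
         (card (carrier (F j)) = p \<and> unit_powers (F j) k = {\<one>\<^bsub>F j\<^esub>})))"
    (is "?L \<longleftrightarrow> ?full \<and> \<not> ?clash")
proof
  assume L: ?L
  have ?full
    using \<pi>_image_unit_power_span L \<pi>_image by metis
  moreover have "\<not> ?clash"
    using equal_characteristic_obstruction L by blast
  ultimately show "?full \<and> \<not> ?clash" by blast
next
  assume R: "?full \<and> \<not> ?clash"
  have prime_card: "prime (card (carrier (F i)))"
    if i: "i < s" and U: "unit_powers (F i) k = {\<one>\<^bsub>F i\<^esub>}" for i
  proof -
    interpret Fi: field "F i" by (rule field[OF i])
    have fin: "finite (carrier (F i))" by (rule finite_residue_field[OF i])
    have "primitive_divisor 1 (card (carrier (F i)))"
      using Fi.unit_power_span_eq_carrier_iff_primitive[OF fin k1] Fi.unit_powers_trivial_iff[OF fin k1] R i U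
      by metis
    thus ?thesis by (rule prime_of_primitive_divisor_one)
  qed
  have "carrier R \<subseteq> unit_power_span R k"
  proof (rule carrier_subset_unit_power_span[OF k])
    fix i j assume i: "i < s" and j: "j < s" and ij: "i \<noteq> j"
    show "\<exists>w\<in>unit_power_span R k. \<pi> i w \<noteq> \<zero>\<^bsub>F i\<^esub> \<and> \<pi> j w = \<zero>\<^bsub>F j\<^esub>"
    proof (rule unit_power_span_separate[OF i j ij])
      show "unit_powers (F i) k \<noteq> {\<one>\<^bsub>F i\<^esub>} \<or> unit_powers (F j) k \<noteq> {\<one>\<^bsub>F j\<^esub>} \<or>
          coprime (card (carrier (F i))) (card (carrier (F j)))"
      proof (rule ccontr)
        assume neg: "\<not> ?thesis"
        hence U: "unit_powers (F i) k = {\<one>\<^bsub>F i\<^esub>}" "unit_powers (F j) k = {\<one>\<^bsub>F j\<^esub>}"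
          by auto
        hence "card (carrier (F i)) = card (carrier (F j))"
          using prime_card[OF i] prime_card[OF j] primes_coprime neg by metis
        thus False
          using R i j ij U prime_card[OF j] by metis
      qed
    qed (use R in blast)
  qed (use R in blast)
  thus ?L
    using subringE(1)[OF subring_unit_power_span] by blast
qed

end

section \<open>Products of local rings\<close>

lemma RDirProd_list_nth_hom:
  assumes "i < length Rs"
  shows "(\<lambda>as. as ! i) \<in> ring_hom (RDirProd_list Rs) (Rs ! i)"
  using assms
proof (induction Rs arbitrary: i)
  case (Cons R Rs)
  let ?P = "RDirProd_list (R # Rs)"
  have hom: "(\<lambda>(a, as). a # as) \<in> ring_hom (RDirProd R (RDirProd_list Rs)) ?P"
    by (rule RDirProd_list_hom1)
  have ops: "(a # as) \<otimes>\<^bsub>?P\<^esub> (b # bs) = (a \<otimes>\<^bsub>R\<^esub> b) # (as \<otimes>\<^bsub>RDirProd_list Rs\<^esub> bs)"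
      "(a # as) \<oplus>\<^bsub>?P\<^esub> (b # bs) = (a \<oplus>\<^bsub>R\<^esub> b) # (as \<oplus>\<^bsub>RDirProd_list Rs\<^esub> bs)"
    if "a \<in> carrier R" "as \<in> carrier (RDirProd_list Rs)" "b \<in> carrier R" "bs \<in> carrier (RDirProd_list Rs)"
    for a as b bs
    using ring_hom_mult[OF hom, of "(a, as)" "(b, bs)"] ring_hom_add[OF hom, of "(a, as)" "(b, bs)"] that
    by (simp_all add: RDirProd_carrier) (simp_all add: RDirProd_def DirProd_def monoid.defs)
  have one: "\<one>\<^bsub>?P\<^esub> = \<one>\<^bsub>R\<^esub> # \<one>\<^bsub>RDirProd_list Rs\<^esub>"
    by (simp add: RDirProd_list_one)
  show ?case
  proof (cases i)
    case 0
    show ?thesis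
      unfolding 0 by (rule ring_hom_memI) (auto simp: RDirProd_list_carrier ops one)
  next
    case (Suc n)
    hence IH: "(\<lambda>as. as ! n) \<in> ring_hom (RDirProd_list Rs) (Rs ! n)"
      using Cons by simp
    show ?thesis
      unfolding Suc
      by (rule ring_hom_memI)
         (auto simp: RDirProd_list_carrier ops one ring_hom_mult[OF IH] ring_hom_add[OF IH]
           ring_hom_one[OF IH] ring_hom_closed[OF IH])
  qed
qed simp

lemma ring_hom_nthI:
  assumes "h \<in> ring_hom R (RDirProd_list Rs)" "i < length Rs"
  shows "(\<lambda>x. h x ! i) \<in> ring_hom R (Rs ! i)"
  using ring_hom_trans[OF assms(1) RDirProd_list_nth_hom[OF assms(2)]] by (simp add: comp_def)

lemma (in cring) nonunit_in_maximalideal: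
  assumes fin: "finite (carrier R)" and x: "x \<in> carrier R" "x \<notin> Units R"
  shows "\<exists>M. maximalideal M R \<and> x \<in> M"
proof -
  let ?I = "{I. ideal I R \<and> x \<in> I \<and> I \<noteq> carrier R}"
  have "?I \<subseteq> Pow (carrier R)"
    by (auto dest: ideal.Icarr)
  hence finI: "finite ?I" using fin finite_subset by blast
  have "PIdl x \<noteq> carrier R"
  proof
    assume "PIdl x = carrier R"
    hence "\<one> \<in> PIdl x" by simp
    then obtain y where "y \<in> carrier R" "\<one> = y \<otimes> x"
      by (auto simp: cgenideal_def)
    thus False using x m_comm by (auto simp: Units_def)
  qed
  hence "PIdl x \<in> ?I"
    using cgenideal_ideal[OF x(1)] cgenideal_self[OF x(1)] by auto
  hence "?I \<noteq> {}" by blast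
  from finite_has_maximal[OF finI this]
  obtain M where M: "M \<in> ?I" "\<forall>I\<in>?I. M \<subseteq> I \<longrightarrow> M = I" ..
  have "maximalideal M R"
  proof (rule maximalidealI)
    fix J assume J: "ideal J R" "M \<subseteq> J" "J \<subseteq> carrier R"
    show "J = M \<or> J = carrier R"
      using M(1) bspec[OF M(2), of J] J by (cases "J = carrier R") auto
  qed (use M(1) in auto)
  thus ?thesis using M(1) by auto
qed

text \<open>
  A nonunit lies in some maximal ideal, and a local ring has only one.
\<close>

lemma local_ring_Units:
  assumes "local_ring_with R M" and fin: "finite (carrier R)" and "x \<in> carrier R" "x \<notin> M"
  shows "x \<in> Units R"
  using assms cring.nonunit_in_maximalideal[of R x] unfolding local_ring_with_def by blast

text \<open>
  Units of a product are found componentwise, and in each local factor an element that is nonzero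
  in the residue field is a unit.
\<close>

lemma residue_field_decomposition_product:
  fixes R :: "('a, 'm) ring_scheme" and Rs :: "('b, 'n) ring_scheme list"
  assumes R: "cring R" and fin: "finite (carrier R)" and iso: "R \<simeq> RDirProd_list Rs"
    and loc: "\<And>i. i < length Rs \<Longrightarrow> local_ring_with (Rs ! i) (M i)"
  obtains \<pi> where "residue_field_decomposition R (\<lambda>i. Rs ! i Quot M i) \<pi> (length Rs)"
proof -
  obtain h where h: "h \<in> ring_hom R (RDirProd_list Rs)" "bij_betw h (carrier R) (carrier (RDirProd_list Rs))"
    using iso unfolding is_ring_iso_def ring_iso_def by auto
  note nth_hom = ring_hom_nthI[OF h(1)]
  have cr: "cring (Rs ! i)" and maxi: "maximalideal (M i) (Rs ! i)" if "i < length Rs" for i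
    using loc[OF that] by (auto simp: local_ring_with_def)
  have surj: "\<exists>x\<in>carrier R. \<forall>i<length Rs. h x ! i = y i"
    if "\<And>i. i < length Rs \<Longrightarrow> y i \<in> carrier (Rs ! i)" for y
  proof -
    have "map y [0..<length Rs] \<in> carrier (RDirProd_list Rs)"
      by (rule RDirProd_list_carrier_memI) (use that in auto)
    then obtain x where "x \<in> carrier R" "h x = map y [0..<length Rs]"
      using h(2) by (metis bij_betw_imp_surj_on imageE)
    thus ?thesis by (intro bexI[of _ x]) auto
  qed
  have inj: "x = y" if "x \<in> carrier R" "y \<in> carrier R" "\<And>i. i < length Rs \<Longrightarrow> h x ! i = h y ! i" for x y
  proof -
    have "h x \<in> carrier (RDirProd_list Rs)" "h y \<in> carrier (RDirProd_list Rs)"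
      using that h(1) ring_hom_closed by metis+
    hence "h x = h y"
      using that(3) RDirProd_list_carrier_mem(1) by (metis nth_equalityI)
    thus ?thesis using that(1,2) h(2) by (metis bij_betw_imp_inj_on inj_onD)
  qed
  have fin_Rs: "finite (carrier (Rs ! i))" if i: "i < length Rs" for i
  proof -
    have "carrier (Rs ! i) \<subseteq> (\<lambda>x. h x ! i) ` carrier R"
    proof
      fix y assume y: "y \<in> carrier (Rs ! i)"
      define v where "v = (\<lambda>j. if j = i then y else \<one>\<^bsub>Rs ! j\<^esub>)"
      have "v j \<in> carrier (Rs ! j)" if "j < length Rs" for j
      proof -
        interpret Rj: cring "Rs ! j" by (rule cr[OF that])
        show ?thesis using y by (auto simp: v_def)
      qed
      from surj[of v, OF this] obtain x where "x \<in> carrier R" "\<forall>j<length Rs. h x ! j = v j"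
        by blast
      thus "y \<in> (\<lambda>x. h x ! i) ` carrier R"
        using i by (intro image_eqI[of _ _ x]) (auto simp: v_def)
    qed
    thus ?thesis using fin finite_subset by blast
  qed
  define \<pi> where "\<pi> = (\<lambda>i x. M i +>\<^bsub>Rs ! i\<^esub> h x ! i)"
  have "residue_field_decomposition R (\<lambda>i. Rs ! i Quot M i) \<pi> (length Rs)"
  proof (intro residue_field_decomposition.intro[OF R] residue_field_decomposition_axioms.intro)
    show "finite (carrier R)" by (rule fin)
  next
    fix i assume i: "i < length Rs"
    show "field (Rs ! i Quot M i)"
      by (rule maximalideal.quotient_is_field[OF maxi[OF i] cr[OF i]])
    interpret I: maximalideal "M i" "Rs ! i" by (rule maxi[OF i])
    show "\<pi> i \<in> ring_hom R (Rs ! i Quot M i)"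
      using ring_hom_trans[OF nth_hom[OF i] I.rcos_ring_hom] by (simp add: \<pi>_def comp_def)
  next
    fix y assume y: "\<And>i. i < length Rs \<Longrightarrow> y i \<in> carrier (Rs ! i Quot M i)"
    have "\<exists>z. z \<in> carrier (Rs ! i) \<and> y i = M i +>\<^bsub>Rs ! i\<^esub> z" if "i < length Rs" for i
      using y[OF that] by (auto simp: FactRing_def A_RCOSETS_def')
    then obtain z where z: "\<And>i. i < length Rs \<Longrightarrow> z i \<in> carrier (Rs ! i) \<and> y i = M i +>\<^bsub>Rs ! i\<^esub> z i"
      by metis
    hence "\<And>i. i < length Rs \<Longrightarrow> z i \<in> carrier (Rs ! i)" by blast
    from surj[of z, OF this] obtain x where x: "x \<in> carrier R" "\<forall>i<length Rs. h x ! i = z i"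
      by blast
    have "\<forall>i<length Rs. \<pi> i x = y i" using x(2) z by (simp add: \<pi>_def)
    thus "\<exists>x\<in>carrier R. \<forall>i<length Rs. \<pi> i x = y i"
      using x(1) by blast
  next
    fix x assume x: "x \<in> carrier R" and nz: "\<And>i. i < length Rs \<Longrightarrow> \<pi> i x \<noteq> \<zero>\<^bsub>Rs ! i Quot M i\<^esub>"
    have "\<exists>y. y \<in> carrier (Rs ! i) \<and> h x ! i \<otimes>\<^bsub>Rs ! i\<^esub> y = \<one>\<^bsub>Rs ! i\<^esub>" if i: "i < length Rs" for i
    proof -
      interpret I: maximalideal "M i" "Rs ! i" by (rule maxi[OF i])
      have "h x ! i \<notin> M i"
        using nz[OF i] I.a_rcos_const by (auto simp: \<pi>_def FactRing_def)
      hence "h x ! i \<in> Units (Rs ! i)"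
        using local_ring_Units[OF loc[OF i] fin_Rs[OF i]] ring_hom_closed[OF nth_hom[OF i] x] by simp
      thus ?thesis by (auto simp: Units_def)
    qed
    then obtain y where y: "\<And>i. i < length Rs \<Longrightarrow> y i \<in> carrier (Rs ! i) \<and> h x ! i \<otimes>\<^bsub>Rs ! i\<^esub> y i = \<one>\<^bsub>Rs ! i\<^esub>"
      by metis
    then obtain z where z: "z \<in> carrier R" "\<And>i. i < length Rs \<Longrightarrow> h z ! i = y i"
      using surj[of y] by blast
    interpret R: cring R by (rule R)
    have "x \<otimes>\<^bsub>R\<^esub> z = \<one>\<^bsub>R\<^esub>"
    proof (rule inj)
      fix i assume i: "i < length Rs"
      show "h (x \<otimes>\<^bsub>R\<^esub> z) ! i = h \<one>\<^bsub>R\<^esub> ! i"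
        using ring_hom_mult[OF nth_hom[OF i] x z(1)] ring_hom_one[OF nth_hom[OF i]] y[OF i] z(2)[OF i]
        by simp
    qed (use x z in auto)
    thus "x \<in> Units R"
      using x z(1) R.m_comm[OF x z(1)] unfolding Units_def by auto
  qed
  thus thesis by (rule that)
qed

section \<open>The connectedness criterion\<close>

theorem theorem9p6:
  fixes R :: "('a, 'm) ring_scheme"
    and Rs :: "('b, 'n) ring_scheme list"
    and M :: "nat \<Rightarrow> 'b set"
    and q :: "nat \<Rightarrow> nat"
    and k s :: nat
  assumes "cring R" and "finite (carrier R)"
    and "1 \<le> s" and "length Rs = s"
    and "R \<simeq> RDirProd_list Rs"
    and "\<And>i. i < s \<Longrightarrow> local_ring_with (Rs ! i) (M i)"
    and "\<And>i. i < s \<Longrightarrow> q i = card (carrier (Rs ! i Quot M i))"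
    and "1 \<le> k"
    and "gcd k (card (carrier R)) = 1"
  shows "strongly_or_undirected_connected (unit_power_graph R k) \<longleftrightarrow>
     (\<forall>i<s. primitive_divisor ((q i - 1) div gcd k (q i - 1)) (q i)) \<and>
     \<not> (\<exists>i<s. \<exists>j<s. i \<noteq> j \<and>
          (\<exists>p. prime p \<and>
               digraph_iso (unit_power_graph (Rs ! i Quot M i) k) (paley_graph_prime (p - 1) p) \<and>
               digraph_iso (paley_graph_prime (p - 1) p) (unit_power_graph (Rs ! j Quot M j) k)))"
proof -
  let ?F = "\<lambda>i. Rs ! i Quot M i"
  obtain \<pi> where "residue_field_decomposition R ?F \<pi> (length Rs)"
    using residue_field_decomposition_product[of R Rs M] assms by metis
  then interpret residue_field_decomposition R ?F \<pi> s
    using assms(4) by simp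
  have "strongly_or_undirected_connected (unit_power_graph R k) \<longleftrightarrow> unit_power_span R k = carrier R"
    using connected_cayley_digraph_iff[OF add.comm_group_axioms, of "unit_powers R k"] finite_carrier
      unit_powers_closed by (simp add: unit_power_graph_def unit_power_span_def)
  moreover have "unit_power_span (?F i) k = carrier (?F i) \<longleftrightarrow>
      primitive_divisor ((q i - 1) div gcd k (q i - 1)) (q i)" if "i < s" for i
    using field.unit_power_span_eq_carrier_iff_primitive[OF field[OF that] finite_residue_field[OF that] assms(8)]
      assms(7)[OF that] by simp
  moreover have "digraph_iso (unit_power_graph (?F i) k) (paley_graph_prime (p - 1) p) \<longleftrightarrow>
        card (carrier (?F i)) = p \<and> unit_powers (?F i) k = {\<one>\<^bsub>?F i\<^esub>}"
      "digraph_iso (paley_graph_prime (p - 1) p) (unit_power_graph (?F i) k) \<longleftrightarrow>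
        card (carrier (?F i)) = p \<and> unit_powers (?F i) k = {\<one>\<^bsub>?F i\<^esub>}"
    if "i < s" "prime p" for i p
    using field.digraph_iso_paley_graph_prime_iff[OF field[OF that(1)] finite_residue_field[OF that(1)] that(2)]
    by blast+
  ultimately show ?thesis
    using unit_power_span_eq_carrier_iff[OF assms(8)] assms(9) unfolding coprime_iff_gcd_eq_1 by (smt (verit))
qed

end
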